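(* Let $F = G\circ F_m\circ\cdots\circ F_1:\mathbb{R}^{n_0}\to\mathbb{R}$ be a ReLU neural network of architecture $(n_0,\dots,n_m;1)$. For each $i\in\{1,\dots,m\}$, $\mathcal{C}(F_i\circ\cdots\circ F_1)$ is a polyhedral decomposition of $\mathbb{R}^{n_0}$ satisfying: (i) $F_i\circ\cdots\circ F_1$ is affine-linear on the cells of $\mathcal{C}(F_i\circ\cdots\circ F_1)$; (ii) $\bigcup_{k=1}^{i}\mathcal{B}_F^{(k)}$ is the domain (underlying set) of a polyhedral subcomplex of $\mathcal{C}(F_i\circ\cdots\circ F_1)$. In particular, $F$ is continuous and affine-linear on the cells of the polyhedral decomposition $\mathcal{C}(F)=\mathcal{C}(F_m\circ\cdots\circ F_1)$ of $\mathbb{R}^{n_0}$.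
   Context: **ReLU networks.** $\mathrm{ReLU}(x)=\max\{0,x\}$, and $\sigma:\mathbb{R}^n\to\mathbb{R}^n$ applies ReLU to each coordinate. A ReLU neural network of architecture $(n_0,\dots,n_m;1)$ (positive integers $n_0,\ldots,n_m$, $n_{m+1}=1$) is a sequence of affine maps $A_i:\mathbb{R}^{n_{i-1}}\to\mathbb{R}^{n_i}$, $i=1,\dots,m+1$; its layer maps are $F_i=\sigma\circ A_i$ for $i\le m$ and $G=A_{m+1}$, and the network map is $F=G\circ F_m\circ\cdots\circ F_1$. **Hyperplane arrangement of a layer.** Write $A_i(x)=Wx+b$. The $j$-th row gives the set $S_j=\{x: W_j\cdot x+b_j=0\}$. It is degenerate if $W_j=0$, and otherwise it is an affine hyperplane. The hyperplane arrangement $\mathcal{A}^{(i)}$ in $\mathbb{R}^{n_{i-1}}$ associated to $F_i$ is the finite set of the nondegenerate $S_j$. **Polyhedral complexes.** A polyhedral set is a finite intersection of closed affine half-spaces. Its faces are $\emptyset$, itself, and its intersections with supporting hyperplanes. A polyhedral complex is a finite set of polyhedral sets (cells) closed under taking faces and such that any two cells intersect in a common face. Its domain is the union of its cells. It is a polyhedral decomposition of $\mathbb{R}^n$ if its domain is $\mathbb{R}^n$. A subcomplex is a subset of the cells closed under taking faces. A map is affine-linear on cells if its restriction to each cell is affine-linear. A hyperplane arrangement $\mathcal{A}$ in $\mathbb{R}^n$ induces the polyhedral decomposition $\mathcal{C}(\mathcal{A})$ whose $n$-cells are the closures of the connected components of $\mathbb{R}^n\setminus\bigcup_{H\in\mathcal{A}}H$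 and whose other cells are the faces of these. **Level set complex.** If $M$ is a polyhedral complex, $f:|M|\to\mathbb{R}^r$ is affine-linear on cells of $M$, and $R$ is a polyhedral complex in $\mathbb{R}^r$, then $M_{\in R}:=\{S\cap f^{-1}(Y): S\in M,\ Y\in R\}$. **Canonical complex.** Let $R^{(i)}=\mathcal{C}(\mathcal{A}^{(i)})$, a polyhedral decomposition of $\mathbb{R}^{n_{i-1}}$. Set $\mathcal{C}(F_1):=R^{(1)}$ and, for $i=2,\dots,m$, $\mathcal{C}(F_i\circ\cdots\circ F_1):=\mathcal{C}(F_{i-1}\circ\cdots\circ F_1)_{\in R^{(i)}}$, the level set complex with respect to the map $F_{i-1}\circ\cdots\circ F_1$. The canonical polyhedral complex of $F$ is $\mathcal{C}(F):=\mathcal{C}(F_m\circ\cdots\circ F_1)$. **Bent hyperplanes.** $\mathcal{B}_F^{(1)}=\bigcup_{H\in\mathcal{A}^{(1)}}H$, and for $2\le k\le m$, $\mathcal{B}_F^{(k)}=\bigcup_{H\in\mathcal{A}^{(k)}}(F_{k-1}\circ\cdots\circ F_1)^{-1}(H)\subseteq\mathbb{R}^{n_0}$. *)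

theory Defs
  imports "HOL-Analysis.Analysis"
begin

text \<open>
  The dimensions of the layers of a network vary inside the statement, so \<open>\<real>\<^sup>n\<close> is rendered as
  the carrier of the library topology \<^const>\<open>Euclidean_space\<close>: the real sequences vanishing at
  all indices \<open>\<ge> n\<close>. Coordinates are numbered from \<open>0\<close>.
\<close>

abbreviation Rn :: "nat \<Rightarrow> (nat \<Rightarrow> real) set" where
  "Rn n \<equiv> topspace (Euclidean_space n)"


section \<open>Affine maps, hyperplanes and half-spaces\<close>

definition affine_form :: "nat \<Rightarrow> (nat \<Rightarrow> real) \<Rightarrow> real \<Rightarrow> (nat \<Rightarrow> real) \<Rightarrow> real" where
  "affine_form n a c x = (\<Sum>k<n. a k * x k) + c"

text \<open>The map \<open>x \<mapsto> V x + c\<close> from \<open>\<real>\<^sup>n\<close> to \<open>\<real>\<^sup>r\<close>; \<open>V j\<close> is the \<open>j\<close>-th row of the matrix.\<close>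

definition affine_map ::
    "nat \<Rightarrow> nat \<Rightarrow> (nat \<Rightarrow> nat \<Rightarrow> real) \<Rightarrow> (nat \<Rightarrow> real) \<Rightarrow> (nat \<Rightarrow> real) \<Rightarrow> (nat \<Rightarrow> real)" where
  "affine_map n r V c x = (\<lambda>j. if j < r then affine_form n (V j) (c j) x else 0)"

text \<open>Only the first \<open>n\<close> entries of a normal vector of a hyperplane in \<open>\<real>\<^sup>n\<close> matter.\<close>

definition nonzero_vec :: "nat \<Rightarrow> (nat \<Rightarrow> real) \<Rightarrow> bool" where
  "nonzero_vec n a \<longleftrightarrow> (\<exists>k<n. a k \<noteq> 0)"

definition zero_set :: "nat \<Rightarrow> (nat \<Rightarrow> real) \<Rightarrow> real \<Rightarrow> (nat \<Rightarrow> real) set" where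
  "zero_set n a c = {x \<in> Rn n. affine_form n a c x = 0}"

definition nonpos_set :: "nat \<Rightarrow> (nat \<Rightarrow> real) \<Rightarrow> real \<Rightarrow> (nat \<Rightarrow> real) set" where
  "nonpos_set n a c = {x \<in> Rn n. affine_form n a c x \<le> 0}"

definition closed_half_space :: "nat \<Rightarrow> (nat \<Rightarrow> real) set \<Rightarrow> bool" where
  "closed_half_space n K \<longleftrightarrow> (\<exists>a c. nonzero_vec n a \<and> K = nonpos_set n a c)"


section \<open>Polyhedral complexes\<close>

text \<open>Intersecting with \<^term>\<open>Rn n\<close> makes the empty intersection the whole space.\<close>

definition polyhedral_set :: "nat \<Rightarrow> (nat \<Rightarrow> real) set \<Rightarrow> bool" where
  "polyhedral_set n P \<longleftrightarrow>
     (\<exists>\<K>. finite \<K> \<and> (\<forall>K\<in>\<K>. closed_half_space n K) \<and> P = Rn n \<inter> \<Inter>\<K>)"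

text \<open>
  A supporting hyperplane of \<open>P\<close> meets \<open>P\<close> and has \<open>P\<close> on one side; replacing \<open>(a, c)\<close> by
  \<open>(- a, - c)\<close> switches the sides, so it suffices to name the non-positive one.
\<close>

definition supporting_hyperplane ::
    "nat \<Rightarrow> (nat \<Rightarrow> real) set \<Rightarrow> (nat \<Rightarrow> real) set \<Rightarrow> bool" where
  "supporting_hyperplane n P H \<longleftrightarrow>
     (\<exists>a c. nonzero_vec n a \<and> H = zero_set n a c \<and> P \<subseteq> nonpos_set n a c \<and> P \<inter> H \<noteq> {})"

definition is_face :: "nat \<Rightarrow> (nat \<Rightarrow> real) set \<Rightarrow> (nat \<Rightarrow> real) set \<Rightarrow> bool" where
  "is_face n Q P \<longleftrightarrow> Q = {} \<or> Q = P \<or> (\<exists>H. supporting_hyperplane n P H \<and> Q = P \<inter> H)"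

definition face_closed :: "nat \<Rightarrow> (nat \<Rightarrow> real) set set \<Rightarrow> bool" where
  "face_closed n \<M> \<longleftrightarrow> (\<forall>P\<in>\<M>. \<forall>Q. is_face n Q P \<longrightarrow> Q \<in> \<M>)"

definition polyhedral_complex :: "nat \<Rightarrow> (nat \<Rightarrow> real) set set \<Rightarrow> bool" where
  "polyhedral_complex n \<M> \<longleftrightarrow>
     finite \<M> \<and> (\<forall>P\<in>\<M>. polyhedral_set n P) \<and> face_closed n \<M> \<and>
     (\<forall>P\<in>\<M>. \<forall>Q\<in>\<M>. is_face n (P \<inter> Q) P \<and> is_face n (P \<inter> Q) Q)"

definition polyhedral_decomposition :: "nat \<Rightarrow> (nat \<Rightarrow> real) set set \<Rightarrow> bool" where
  "polyhedral_decomposition n \<M> \<longleftrightarrow> polyhedral_complex n \<M> \<and> \<Union>\<M> = Rn n"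

definition polyhedral_subcomplex ::
    "nat \<Rightarrow> (nat \<Rightarrow> real) set set \<Rightarrow> (nat \<Rightarrow> real) set set \<Rightarrow> bool" where
  "polyhedral_subcomplex n \<N> \<M> \<longleftrightarrow> \<N> \<subseteq> \<M> \<and> face_closed n \<N>"

definition affine_linear_on_cells ::
    "nat \<Rightarrow> nat \<Rightarrow> ((nat \<Rightarrow> real) \<Rightarrow> (nat \<Rightarrow> real)) \<Rightarrow> (nat \<Rightarrow> real) set set \<Rightarrow> bool" where
  "affine_linear_on_cells n r f \<M> \<longleftrightarrow> (\<forall>S\<in>\<M>. \<exists>V c. \<forall>x\<in>S. f x = affine_map n r V c x)"

definition level_set_complex ::
    "(nat \<Rightarrow> real) set set \<Rightarrow> ((nat \<Rightarrow> real) \<Rightarrow> (nat \<Rightarrow> real)) \<Rightarrow> (nat \<Rightarrow> real) set set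
      \<Rightarrow> (nat \<Rightarrow> real) set set" where
  "level_set_complex \<M> f \<R> = {S \<inter> f -` Y | S Y. S \<in> \<M> \<and> Y \<in> \<R>}"

definition arrangement_top_cells :: "nat \<Rightarrow> (nat \<Rightarrow> real) set set \<Rightarrow> (nat \<Rightarrow> real) set set" where
  "arrangement_top_cells n \<A> =
     (\<lambda>K. Euclidean_space n closure_of K) `
       connected_components_of (subtopology (Euclidean_space n) (Rn n - \<Union>\<A>))"

definition arrangement_complex :: "nat \<Rightarrow> (nat \<Rightarrow> real) set set \<Rightarrow> (nat \<Rightarrow> real) set set" where
  "arrangement_complex n \<A> = {Q. \<exists>P\<in>arrangement_top_cells n \<A>. is_face n Q P}"


section \<open>ReLU networks\<close>

text \<open>
  A network is given by its widths \<open>n 0, \<dots>, n (m + 1)\<close> and, for \<open>1 \<le> i \<le> m + 1\<close>, the matrix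
  \<open>W i\<close> and bias vector \<open>b i\<close> of the affine map \<open>A\<^sub>i\<close> from \<^term>\<open>Rn (n (i - 1))\<close> to
  \<^term>\<open>Rn (n i)\<close>. Entries of \<open>W\<close> and \<open>b\<close> outside these ranges are never used.
\<close>

type_synonym weights = "nat \<Rightarrow> nat \<Rightarrow> nat \<Rightarrow> real"
type_synonym biases = "nat \<Rightarrow> nat \<Rightarrow> real"

definition relu :: "(nat \<Rightarrow> real) \<Rightarrow> (nat \<Rightarrow> real)" where
  "relu x = (\<lambda>j. max 0 (x j))"

definition layer_affine ::
    "(nat \<Rightarrow> nat) \<Rightarrow> weights \<Rightarrow> biases \<Rightarrow> nat \<Rightarrow> (nat \<Rightarrow> real) \<Rightarrow> (nat \<Rightarrow> real)" where
  "layer_affine n W b i = affine_map (n (i - 1)) (n i) (W i) (b i)"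

definition layer_map ::
    "(nat \<Rightarrow> nat) \<Rightarrow> weights \<Rightarrow> biases \<Rightarrow> nat \<Rightarrow> (nat \<Rightarrow> real) \<Rightarrow> (nat \<Rightarrow> real)" where
  "layer_map n W b i = relu \<circ> layer_affine n W b i"

text \<open>\<open>layers_comp n W b i\<close> is \<open>F\<^sub>i \<circ> \<dots> \<circ> F\<^sub>1\<close>, the identity for \<open>i = 0\<close>.\<close>

primrec layers_comp ::
    "(nat \<Rightarrow> nat) \<Rightarrow> weights \<Rightarrow> biases \<Rightarrow> nat \<Rightarrow> (nat \<Rightarrow> real) \<Rightarrow> (nat \<Rightarrow> real)" where
  "layers_comp n W b 0 = id"
| "layers_comp n W b (Suc i) = layer_map n W b (Suc i) \<circ> layers_comp n W b i"

definition network_map ::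
    "(nat \<Rightarrow> nat) \<Rightarrow> nat \<Rightarrow> weights \<Rightarrow> biases \<Rightarrow> (nat \<Rightarrow> real) \<Rightarrow> (nat \<Rightarrow> real)" where
  "network_map n m W b = layer_affine n W b (m + 1) \<circ> layers_comp n W b m"

definition layer_arrangement ::
    "(nat \<Rightarrow> nat) \<Rightarrow> weights \<Rightarrow> biases \<Rightarrow> nat \<Rightarrow> (nat \<Rightarrow> real) set set" where
  "layer_arrangement n W b i =
     {zero_set (n (i - 1)) (W i j) (b i j) | j. j < n i \<and> nonzero_vec (n (i - 1)) (W i j)}"

definition layer_complex ::
    "(nat \<Rightarrow> nat) \<Rightarrow> weights \<Rightarrow> biases \<Rightarrow> nat \<Rightarrow> (nat \<Rightarrow> real) set set" where
  "layer_complex n W b i = arrangement_complex (n (i - 1)) (layer_arrangement n W b i)"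

text \<open>
  \<open>layers_complex n W b i\<close> is \<open>\<C>(F\<^sub>i \<circ> \<dots> \<circ> F\<^sub>1)\<close> for \<open>i \<ge> 1\<close>; the value at \<open>i = 0\<close> is left
  unspecified.
\<close>

fun layers_complex ::
    "(nat \<Rightarrow> nat) \<Rightarrow> weights \<Rightarrow> biases \<Rightarrow> nat \<Rightarrow> (nat \<Rightarrow> real) set set" where
  "layers_complex n W b (Suc 0) = layer_complex n W b 1"
| "layers_complex n W b (Suc (Suc i)) =
     level_set_complex (layers_complex n W b (Suc i)) (layers_comp n W b (Suc i))
       (layer_complex n W b (Suc (Suc i)))"

definition canonical_complex ::
    "(nat \<Rightarrow> nat) \<Rightarrow> nat \<Rightarrow> weights \<Rightarrow> biases \<Rightarrow> (nat \<Rightarrow> real) set set" where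
  "canonical_complex n m W b = layers_complex n W b m"

text \<open>
  For \<open>k = 1\<close> the map in front is the identity, so this is the union of the hyperplanes of the
  first layer.
\<close>

definition bent_hyperplanes ::
    "(nat \<Rightarrow> nat) \<Rightarrow> weights \<Rightarrow> biases \<Rightarrow> nat \<Rightarrow> (nat \<Rightarrow> real) set" where
  "bent_hyperplanes n W b k =
     (\<Union>H\<in>layer_arrangement n W b k. {x \<in> Rn (n 0). layers_comp n W b (k - 1) x \<in> H})"

end

theory Submission
  imports Defs
begin

text \<open>
  A nonempty face of a polyhedron given by finitely many affine inequalities is obtained by turning
  some of the inequalities into equations: prolonging a segment beyond a generic point of the face
  shows that the inequalities tight on the whole face already cut it out. Conversely, the locus where
  finitely many forms of constant sign on the polyhedron vanish is a face. All intersection and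
  face-closure properties reduce to this. The top cells of an arrangement are the closed sign cells
  of points off the hyperplanes. If \<open>f\<close> is affine on \<open>S\<close>, the inequalities of
  \<open>S \<inter> f\<^sup>-\<^sup>1(Y)\<close> are those of \<open>S\<close> and the pullbacks of those of \<open>Y\<close>, so its faces are the sets
  \<open>S' \<inter> f\<^sup>-\<^sup>1(Y')\<close> for faces \<open>S'\<close> and \<open>Y'\<close>. The statement follows by induction on the number of
  layers; the bent hyperplanes form the subcomplex of all cells contained in their union.
\<close>

section \<open>Affine forms\<close>

text \<open>A normal vector and a constant are paired so that finite systems of inequalities or
  equations become finite sets of pairs.\<close>

abbreviation form :: "nat \<Rightarrow> (nat \<Rightarrow> real) \<times> real \<Rightarrow> (nat \<Rightarrow> real) \<Rightarrow> real" where
  "form n p \<equiv> affine_form n (fst p) (snd p)"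

text \<open>The parameter \<open>t\<close> is unrestricted: values in \<open>[0, 1]\<close> give
  segments, negative values prolong a segment beyond \<open>x\<close>.\<close>

lemma affine_form_line:
  "affine_form n a c (\<lambda>i. (1 - t) * x i + t * y i) =
     (1 - t) * affine_form n a c x + t * affine_form n a c y"
  by (simp add: affine_form_def algebra_simps sum.distrib sum_distrib_left sum_subtractf)

lemma affine_form_add:
  "affine_form n (\<lambda>k. a k + a' k) (c + c') x = affine_form n a c x + affine_form n a' c' x"
  by (simp add: affine_form_def algebra_simps sum.distrib)

lemma affine_form_uminus: "affine_form n (\<lambda>k. - a k) (- c) x = - affine_form n a c x"
  by (simp add: affine_form_def sum_negf)

lemma affine_form_scale: "affine_form n (\<lambda>k. d * a k) (d * c) x = d * affine_form n a c x"
  by (simp add: affine_form_def algebra_simps sum_distrib_left)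

text \<open>Interchanging the two sums shows that an affine form pulled back along an affine map is
  again one, with the transposed matrix applied to its normal vector.\<close>

lemma affine_form_affine_map:
  "affine_form r a c (affine_map n r V d x) =
     affine_form n (\<lambda>k. \<Sum>j<r. a j * V j k) ((\<Sum>j<r. a j * d j) + c) x"
proof -
  have "(\<Sum>j<r. \<Sum>k<n. a j * (V j k * x k)) = (\<Sum>k<n. \<Sum>j<r. a j * (V j k * x k))"
    by (rule sum.swap)
  then show ?thesis
    by (simp add: affine_form_def affine_map_def sum_distrib_left sum_distrib_right
        distrib_left sum.distrib mult.assoc)
qed

lemma affine_map_affine_map:
  "affine_map r s V c (affine_map n r V' c' x) =
     affine_map n s (\<lambda>j k. \<Sum>i<r. V j i * V' i k) (\<lambda>j. (\<Sum>i<r. V j i * c' i) + c j) x"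
  unfolding affine_map_def [of r s] affine_map_def [of n s]
  by (auto simp: fun_eq_iff affine_form_affine_map)

lemma affine_form_const: "\<not> nonzero_vec n a \<Longrightarrow> affine_form n a c x = c"
  by (simp add: affine_form_def nonzero_vec_def)

lemma Rn_line: "\<lbrakk>x \<in> Rn n; y \<in> Rn n\<rbrakk> \<Longrightarrow> (\<lambda>i. (1 - t) * x i + t * y i) \<in> Rn n"
  by (simp add: topspace_Euclidean_space)

lemma affine_map_in_Rn: "affine_map n r V c x \<in> Rn r"
  by (simp add: affine_map_def topspace_Euclidean_space)

section \<open>Continuity of affine maps and of lines\<close>

lemma continuous_map_affine_form:
  "continuous_map (Euclidean_space n) euclideanreal (affine_form n a c)"
proof -
  have "continuous_map (Euclidean_space n) euclideanreal (\<lambda>x. x k)" for k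
    unfolding Euclidean_space_def
    by (intro continuous_map_from_subtopology continuous_map_product_coordinates) auto
  then show ?thesis
    unfolding affine_form_def by (intro continuous_intros) auto
qed

lemma continuous_map_affine_map:
  "continuous_map (Euclidean_space n) (Euclidean_space r) (affine_map n r V c)"
  unfolding affine_map_def
  by (simp add: continuous_map_componentwise_Euclidean_space continuous_map_affine_form)

lemma continuous_map_line:
  assumes "x \<in> Rn n" "y \<in> Rn n"
  shows "continuous_map euclideanreal (Euclidean_space n) (\<lambda>t i. (1 - t) * x i + t * y i)"
  unfolding Euclidean_space_def continuous_map_in_subtopology continuous_map_componentwise_UNIV
  using assms by (auto simp: topspace_Euclidean_space intro!: continuous_intros)


section \<open>Faces\<close>

lemma is_face_subset: "is_face n Q P \<Longrightarrow> Q \<subseteq> P"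
  by (auto simp: is_face_def)

lemma is_face_refl: "is_face n P P"
  by (simp add: is_face_def)

text \<open>Unlike in the definition of faces, the form may be constant here.\<close>

lemma is_face_iff_form:
  assumes "P \<subseteq> Rn n"
  shows "is_face n Q P \<longleftrightarrow>
    Q = {} \<or> (\<exists>p. (\<forall>x\<in>P. form n p x \<le> 0) \<and> Q = {x \<in> P. form n p x = 0})"
proof
  assume "is_face n Q P"
  then consider "Q = {}" | "Q = P" | H where "supporting_hyperplane n P H" "Q = P \<inter> H"
    by (auto simp: is_face_def)
  then show "Q = {} \<or> (\<exists>p. (\<forall>x\<in>P. form n p x \<le> 0) \<and> Q = {x \<in> P. form n p x = 0})"
  proof cases
    case 2
    then have "(\<forall>x\<in>P. form n (\<lambda>_. 0, 0) x \<le> 0) \<and> Q = {x \<in> P. form n (\<lambda>_. 0, 0) x = 0}"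
      by (simp add: affine_form_def)
    then show ?thesis by blast
  next
    case 3
    then obtain a c where "H = zero_set n a c" "P \<subseteq> nonpos_set n a c"
      by (auto simp: supporting_hyperplane_def)
    then have "(\<forall>x\<in>P. form n (a, c) x \<le> 0) \<and> Q = {x \<in> P. form n (a, c) x = 0}"
      using 3 assms by (auto simp: zero_set_def nonpos_set_def)
    then show ?thesis by blast
  qed simp
next
  assume "Q = {} \<or> (\<exists>p. (\<forall>x\<in>P. form n p x \<le> 0) \<and> Q = {x \<in> P. form n p x = 0})"
  then consider "Q = {}"
    | p where "Q \<noteq> {}" "\<forall>x\<in>P. form n p x \<le> 0" "Q = {x \<in> P. form n p x = 0}"
    by blast
  then show "is_face n Q P"
  proof cases
    case 2
    show ?thesis
    proof (cases "nonzero_vec n (fst p)")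
      case True
      have "Q = P \<inter> zero_set n (fst p) (snd p)" "P \<subseteq> nonpos_set n (fst p) (snd p)"
        using 2 assms by (auto simp: zero_set_def nonpos_set_def)
      then show ?thesis
        using True 2(1) unfolding is_face_def supporting_hyperplane_def by blast
    next
      case False
      then have "Q = P"
        using 2 by (auto simp: affine_form_const)
      then show ?thesis by (simp add: is_face_def)
    qed
  qed (simp add: is_face_def)
qed

text \<open>The two supporting forms are added: both are nonpositive on \<open>P\<close>, so the sum
  vanishes exactly where both do.\<close>

lemma is_face_Int:
  assumes P: "P \<subseteq> Rn n" and Q: "is_face n Q P" and Q': "is_face n Q' P"
  shows "is_face n (Q \<inter> Q') P"
proof (cases "Q = {} \<or> Q' = {}")
  case True
  then show ?thesis by (auto simp: is_face_def)
next
  case False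
  with Q Q' obtain p q where
    p: "\<forall>x\<in>P. form n p x \<le> 0" "Q = {x \<in> P. form n p x = 0}" and
    q: "\<forall>x\<in>P. form n q x \<le> 0" "Q' = {x \<in> P. form n q x = 0}"
    unfolding is_face_iff_form [OF P] by blast
  define r where "r = ((\<lambda>k. fst p k + fst q k), snd p + snd q)"
  have r: "form n r x = form n p x + form n q x" for x
    by (simp add: r_def affine_form_add)
  have "\<forall>x\<in>P. form n r x \<le> 0" "Q \<inter> Q' = {x \<in> P. form n r x = 0}"
    using p q unfolding r by fastforce+
  then show ?thesis
    unfolding is_face_iff_form [OF P] by blast
qed

text \<open>After a change of sign each form is nonpositive on \<open>P\<close> and its zero locus
  is a face; these faces are intersected one at a time.\<close>

lemma is_face_tight:
  assumes "finite \<Psi>" and P: "P \<subseteq> Rn n"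
    and "\<And>p. p \<in> \<Psi> \<Longrightarrow> (\<forall>x\<in>P. form n p x \<le> 0) \<or> (\<forall>x\<in>P. 0 \<le> form n p x)"
  shows "is_face n {x \<in> P. \<forall>p\<in>\<Psi>. form n p x = 0} P"
  using assms(1,3)
proof (induction rule: finite_induct)
  case empty
  then show ?case by (simp add: is_face_refl)
next
  case (insert p \<Psi>)
  define p' where "p' = (if \<forall>x\<in>P. form n p x \<le> 0 then p else (\<lambda>k. - fst p k, - snd p))"
  have "\<forall>x\<in>P. form n p' x \<le> 0"
    using insert.prems [of p] by (auto simp: p'_def affine_form_uminus)
  moreover have "form n p' x = 0 \<longleftrightarrow> form n p x = 0" for x
    by (simp add: p'_def affine_form_uminus)
  ultimately have "is_face n {x \<in> P. form n p x = 0} P"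
    unfolding is_face_iff_form [OF P] by blast
  from is_face_Int [OF P this] insert
  have "is_face n ({x \<in> P. form n p x = 0} \<inter> {x \<in> P. \<forall>p\<in>\<Psi>. form n p x = 0}) P"
    by blast
  moreover have "{x \<in> P. form n p x = 0} \<inter> {x \<in> P. \<forall>p\<in>\<Psi>. form n p x = 0} =
      {x \<in> P. \<forall>p\<in>insert p \<Psi>. form n p x = 0}"
    by auto
  ultimately show ?case by simp
qed

text \<open>A hyperplane supporting \<open>P\<close> along a nonempty \<open>Q\<close> also supports
  any set between \<open>Q\<close> and \<open>P\<close>.\<close>

lemma is_face_mono:
  assumes "is_face n Q P" "Q \<subseteq> P'" "P' \<subseteq> P"
  shows "is_face n Q P'"
proof -
  consider "Q = {}" | "Q = P" | H where "Q \<noteq> {}" "supporting_hyperplane n P H" "Q = P \<inter> H"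
    using assms(1) by (auto simp: is_face_def)
  then show ?thesis
  proof cases
    case 3
    then have Q: "Q = P' \<inter> H"
      using assms by blast
    have "P' \<inter> H \<noteq> {}" using Q 3(1) by simp
    then have "supporting_hyperplane n P' H"
      using 3(2) assms(3) unfolding supporting_hyperplane_def by blast
    with Q show ?thesis by (auto simp: is_face_def)
  qed (use assms in \<open>auto simp: is_face_def\<close>)
qed

section \<open>Polyhedra as solution sets of finite systems of inequalities\<close>

definition sublevel :: "nat \<Rightarrow> ((nat \<Rightarrow> real) \<times> real) set \<Rightarrow> (nat \<Rightarrow> real) set" where
  "sublevel n \<Phi> = {x \<in> Rn n. \<forall>p\<in>\<Phi>. form n p x \<le> 0}"

lemma sublevel_subset_Rn: "sublevel n \<Phi> \<subseteq> Rn n"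
  by (auto simp: sublevel_def)

lemma form_midpoint:
  "affine_form n a c (\<lambda>i. (1 - 1/2) * x i + 1/2 * y i) =
     (affine_form n a c x + affine_form n a c y) / 2"
  by (subst affine_form_line) simp

text \<open>Such a point lies in the relative interior of the face.\<close>

lemma face_generic_point:
  assumes "finite \<Phi>" and Q: "Q = {x \<in> sublevel n \<Phi>. form n q x = 0}" "Q \<noteq> {}"
  obtains x where "x \<in> Q" "\<And>p y. \<lbrakk>p \<in> \<Phi>; form n p x = 0; y \<in> Q\<rbrakk> \<Longrightarrow> form n p y = 0"
proof -
  have "\<exists>x\<in>Q. \<forall>p\<in>\<Psi>. form n p x = 0 \<longrightarrow> (\<forall>y\<in>Q. form n p y = 0)" if "finite \<Psi>" "\<Psi> \<subseteq> \<Phi>" for \<Psi>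
    using that
  proof (induction rule: finite_induct)
    case empty
    then show ?case using Q(2) by auto
  next
    case (insert p \<Psi>)
    then obtain x where x: "x \<in> Q" "\<forall>p\<in>\<Psi>. form n p x = 0 \<longrightarrow> (\<forall>y\<in>Q. form n p y = 0)"
      by auto
    show ?case
    proof (cases "\<forall>y\<in>Q. form n p y = 0")
      case True
      then show ?thesis using x by blast
    next
      case False
      then obtain y where y: "y \<in> Q" "form n p y \<noteq> 0" by blast
      \<comment> \<open>The midpoint leaves \<open>p\<close> slack. Since all forms of
        \<open>\<Phi>\<close> are nonpositive at \<open>x\<close> and \<open>y\<close>, one that is
        tight at \<open>z\<close> is tight at both, so what was achieved for \<open>\<Psi>\<close>
        is kept.\<close>
      define z where "z = (\<lambda>i. (1 - 1/2) * x i + 1/2 * y i)"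
      have z: "affine_form n a c z = (affine_form n a c x + affine_form n a c y) / 2" for a c
        unfolding z_def by (rule form_midpoint)
      have nonpos: "form n r x \<le> 0" "form n r y \<le> 0" if "r \<in> \<Phi>" for r
        using x(1) y(1) that unfolding Q sublevel_def by auto
      have "z \<in> Rn n"
        using x(1) y(1) unfolding z_def by (intro Rn_line) (auto simp: Q sublevel_def)
      then have zQ: "z \<in> Q"
        using x(1) y(1) nonpos add_nonpos_nonpos unfolding Q sublevel_def by (fastforce simp: z)
      have tight: "form n r x = 0 \<and> form n r y = 0" if "r \<in> \<Phi>" "form n r z = 0" for r
        using nonpos [OF that(1)] that(2) unfolding z by auto
      have "\<forall>r\<in>insert p \<Psi>. form n r z = 0 \<longrightarrow> (\<forall>w\<in>Q. form n r w = 0)"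
        using tight insert.prems x(2) y(2) by blast
      with zQ show ?thesis by blast
    qed
  qed
  from this [OF assms(1)] that show thesis by blast
qed

text \<open>This makes faces combinatorial: a nonempty face is a choice of inequalities to be turned
  into equations. Finiteness of the set of faces, transitivity and the faces of preimages are read
  off from it.\<close>

lemma is_face_sublevel_iff:
  assumes "finite \<Phi>"
  shows "is_face n Q (sublevel n \<Phi>) \<longleftrightarrow>
    Q = {} \<or> (\<exists>\<Psi>\<subseteq>\<Phi>. Q = {x \<in> sublevel n \<Phi>. \<forall>p\<in>\<Psi>. form n p x = 0})"
proof
  assume "is_face n Q (sublevel n \<Phi>)"
  then consider "Q = {}" | q where "Q \<noteq> {}" "\<forall>x\<in>sublevel n \<Phi>. form n q x \<le> 0"
      "Q = {x \<in> sublevel n \<Phi>. form n q x = 0}"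
    unfolding is_face_iff_form [OF sublevel_subset_Rn] by blast
  then show "Q = {} \<or> (\<exists>\<Psi>\<subseteq>\<Phi>. Q = {x \<in> sublevel n \<Phi>. \<forall>p\<in>\<Psi>. form n p x = 0})"
  proof cases
    case 2
    obtain x where x: "x \<in> Q" "\<And>p y. \<lbrakk>p \<in> \<Phi>; form n p x = 0; y \<in> Q\<rbrakk> \<Longrightarrow> form n p y = 0"
      using face_generic_point [OF assms 2(3,1)] by blast
    define \<Psi> where "\<Psi> = {p \<in> \<Phi>. form n p x = 0}"
    have "y \<in> Q" if y: "y \<in> sublevel n \<Phi>" "\<forall>p\<in>\<Psi>. form n p y = 0" for y
    proof -
      \<comment> \<open>As \<open>x\<close> is generic, the segment from \<open>y\<close> to \<open>x\<close> can be prolonged a little inside the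
        polyhedron. The form \<open>q\<close> is maximal at \<open>x\<close>, so it cannot be negative at \<open>y\<close>.\<close>
      have "\<forall>\<^sub>F e in at_right 0. (1 + e) * form n p x - e * form n p y \<le> 0" if "p \<in> \<Phi>" for p
      proof (cases "form n p x = 0")
        case True
        then show ?thesis
          using y that by (auto simp: \<Psi>_def)
      next
        case False
        \<comment> \<open>A form that is not tight at \<open>x\<close> is strictly negative there
          and, by continuity, stays so on the prolonged segment for small \<open>e\<close>.\<close>
        then have neg: "form n p x < 0"
          using x(1) that by (force simp: 2(3) sublevel_def)
        have "((\<lambda>e. (1 + e) * form n p x - e * form n p y)
            \<longlongrightarrow> (1 + 0) * form n p x - 0 * form n p y) (at_right 0)"
          by (intro tendsto_intros)
        then have "\<forall>\<^sub>F e in at_right 0. (1 + e) * form n p x - e * form n p y < 0"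
          using neg by (intro order_tendstoD(2)) auto
        then show ?thesis by eventually_elim simp
      qed
      then have "\<forall>\<^sub>F e in at_right 0. \<forall>p\<in>\<Phi>. (1 + e) * form n p x - e * form n p y \<le> 0"
        using assms by (intro eventually_ball_finite) auto
      then have "\<forall>\<^sub>F e::real in at_right 0.
          0 < e \<and> (\<forall>p\<in>\<Phi>. (1 + e) * form n p x - e * form n p y \<le> 0)"
        using eventually_at_right_less by eventually_elim simp
      then have "\<exists>e>0. \<forall>p\<in>\<Phi>. (1 + e) * form n p x - e * form n p y \<le> 0"
        using eventually_happens' [OF trivial_limit_at_right_real] by blast
      then obtain e where e: "e > 0" "\<forall>p\<in>\<Phi>. (1 + e) * form n p x - e * form n p y \<le> 0"
        by blast
      define z where "z = (\<lambda>i. (1 - - e) * x i + - e * y i)"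
      have z: "affine_form n a c z = (1 + e) * affine_form n a c x - e * affine_form n a c y" for a c
        unfolding z_def by (subst affine_form_line) simp
      have "z \<in> Rn n"
        using x(1) y(1) unfolding z_def by (intro Rn_line) (auto simp: 2(3) sublevel_def)
      then have "z \<in> sublevel n \<Phi>" using e(2) by (simp add: sublevel_def z)
      then have "form n q z \<le> 0" using 2(2) by blast
      moreover have "form n q x = 0" using x(1) 2(3) by simp
      ultimately have "0 \<le> form n q y" using e(1) by (simp add: z zero_le_mult_iff)
      then show "y \<in> Q" using 2(2,3) y(1) by fastforce
    qed
    moreover have "Q \<subseteq> {x \<in> sublevel n \<Phi>. \<forall>p\<in>\<Psi>. form n p x = 0}"
      using x(2) by (auto simp: \<Psi>_def 2(3))
    ultimately have "Q = {x \<in> sublevel n \<Phi>. \<forall>p\<in>\<Psi>. form n p x = 0}" by blast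
    then show ?thesis unfolding \<Psi>_def by blast
  qed simp
next
  assume "Q = {} \<or> (\<exists>\<Psi>\<subseteq>\<Phi>. Q = {x \<in> sublevel n \<Phi>. \<forall>p\<in>\<Psi>. form n p x = 0})"
  then show "is_face n Q (sublevel n \<Phi>)"
  proof (elim disjE exE conjE)
    fix \<Psi>
    assume "\<Psi> \<subseteq> \<Phi>" "Q = {x \<in> sublevel n \<Phi>. \<forall>p\<in>\<Psi>. form n p x = 0}"
    then show ?thesis
      using is_face_tight [of \<Psi> "sublevel n \<Phi>" n] assms finite_subset sublevel_subset_Rn
      by (auto simp: sublevel_def)
  qed (simp add: is_face_def)
qed

section \<open>Systems of inequalities versus half-spaces; transitivity of faces\<close>

lemma polyhedral_set_sublevel:
  assumes n: "0 < n" and "finite \<Phi>"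
  shows "polyhedral_set n (sublevel n \<Phi>)"
  using assms(2)
proof (induction rule: finite_induct)
  case empty
  show ?case
    unfolding polyhedral_set_def by (intro exI [of _ "{}"]) (simp add: sublevel_def)
next
  case (insert p \<Phi>)
  have "\<exists>\<L>. finite \<L> \<and> (\<forall>K\<in>\<L>. closed_half_space n K) \<and>
      nonpos_set n (fst p) (snd p) = Rn n \<inter> \<Inter>\<L>"
  proof -
    \<comment> \<open>A half-space has a nonzero normal vector, so constant forms are treated apart:
      a nonpositive constant imposes no condition, a positive one leaves the empty set. Such forms
      do arise, as pullbacks along affine maps.\<close>
    consider "nonzero_vec n (fst p)" | "\<not> nonzero_vec n (fst p)" "snd p \<le> 0"
      | "\<not> nonzero_vec n (fst p)" "snd p > 0"
      by linarith
    then show ?thesis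
    proof cases
      case 1
      then show ?thesis
        by (intro exI [of _ "{nonpos_set n (fst p) (snd p)}"])
          (auto simp: closed_half_space_def nonpos_set_def)
    next
      case 2
      then show ?thesis
        by (intro exI [of _ "{}"]) (auto simp: nonpos_set_def affine_form_const)
    next
      case 3
      \<comment> \<open>The empty set, as the intersection of \<open>x\<^sub>0 \<le> -1\<close> and \<open>x\<^sub>0 \<ge> 1\<close>.\<close>
      define u :: "nat \<Rightarrow> real" where "u = (\<lambda>k. if k = 0 then 1 else 0)"
      define v :: "nat \<Rightarrow> real" where "v = (\<lambda>k. - u k)"
      have u: "affine_form n u c x = x 0 + c" for c x
      proof -
        have "(\<Sum>k<n. u k * x k) = (\<Sum>k<n. if k = 0 then x k else 0)"
          by (rule sum.cong) (auto simp: u_def)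
        then show ?thesis using n by (simp add: affine_form_def)
      qed
      have v: "affine_form n v c x = - x 0 + c" for c x
        using affine_form_uminus [of n u "- c" x] by (simp add: v_def u)
      have "nonzero_vec n u" "nonzero_vec n v"
        using n by (auto simp: nonzero_vec_def u_def v_def)
      then have "closed_half_space n (nonpos_set n u 1)" "closed_half_space n (nonpos_set n v 1)"
        by (auto simp: closed_half_space_def)
      moreover have "nonpos_set n u 1 \<inter> nonpos_set n v 1 = {}"
        by (auto simp: nonpos_set_def u v)
      moreover have "nonpos_set n (fst p) (snd p) = {}"
        using 3 by (auto simp: nonpos_set_def affine_form_const)
      ultimately show ?thesis
        by (intro exI [of _ "{nonpos_set n u 1, nonpos_set n v 1}"]) auto
    qed
  qed
  then obtain \<L> where \<L>: "finite \<L>" "\<forall>K\<in>\<L>. closed_half_space n K"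
    "nonpos_set n (fst p) (snd p) = Rn n \<inter> \<Inter>\<L>"
    by blast
  obtain \<K> where \<K>: "finite \<K>" "\<forall>K\<in>\<K>. closed_half_space n K" "sublevel n \<Phi> = Rn n \<inter> \<Inter>\<K>"
    using insert.IH by (auto simp: polyhedral_set_def)
  have "sublevel n (insert p \<Phi>) = nonpos_set n (fst p) (snd p) \<inter> sublevel n \<Phi>"
    by (auto simp: sublevel_def nonpos_set_def)
  also have "\<dots> = Rn n \<inter> \<Inter>(\<K> \<union> \<L>)" unfolding \<L> \<K> by auto
  finally show ?case
    using \<L> \<K> unfolding polyhedral_set_def by (intro exI [of _ "\<K> \<union> \<L>"]) auto
qed

lemma polyhedral_set_iff_sublevel:
  assumes "0 < n"
  shows "polyhedral_set n P \<longleftrightarrow> (\<exists>\<Phi>. finite \<Phi> \<and> P = sublevel n \<Phi>)"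
proof
  assume "polyhedral_set n P"
  then obtain \<K> where \<K>: "finite \<K>" "\<forall>K\<in>\<K>. closed_half_space n K" "P = Rn n \<inter> \<Inter>\<K>"
    by (auto simp: polyhedral_set_def)
  have "\<exists>p. K = nonpos_set n (fst p) (snd p)" if "K \<in> \<K>" for K
  proof -
    from that \<K>(2) obtain a c where "K = nonpos_set n a c"
      by (auto simp: closed_half_space_def)
    then show ?thesis by (intro exI [of _ "(a, c)"]) simp
  qed
  then have "\<exists>p. \<forall>K\<in>\<K>. K = nonpos_set n (fst (p K)) (snd (p K))"
    by (intro bchoice) blast
  then obtain p where p: "\<And>K. K \<in> \<K> \<Longrightarrow> K = nonpos_set n (fst (p K)) (snd (p K))"
    by (elim exE) (rule that, erule bspec)
  have "P = sublevel n (p ` \<K>)"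
  proof -
    have "x \<in> K \<longleftrightarrow> form n (p K) x \<le> 0" if "K \<in> \<K>" "x \<in> Rn n" for K x
    proof -
      have "x \<in> K \<longleftrightarrow> x \<in> nonpos_set n (fst (p K)) (snd (p K))"
        using p [OF that(1)] by (rule arg_cong)
      also have "\<dots> \<longleftrightarrow> form n (p K) x \<le> 0"
        using that(2) by (simp add: nonpos_set_def)
      finally show ?thesis .
    qed
    then show ?thesis unfolding \<K>(3) sublevel_def by blast
  qed
  then show "\<exists>\<Phi>. finite \<Phi> \<and> P = sublevel n \<Phi>" using \<K>(1) by blast
qed (use polyhedral_set_sublevel assms in blast)

text \<open>Forms in \<open>\<Psi>\<close> are already nonpositive on the polyhedron, so each
  equation amounts to the opposite inequality. A face thus has a presentation of the same kind, and
  results on polyhedra apply to it.\<close>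

lemma face_sublevel:
  assumes "\<Psi> \<subseteq> \<Phi>"
  shows "{x \<in> sublevel n \<Phi>. \<forall>p\<in>\<Psi>. form n p x = 0} =
    sublevel n (\<Phi> \<union> (\<lambda>p. (\<lambda>k. - fst p k, - snd p)) ` \<Psi>)"
proof -
  have "(\<forall>p\<in>\<Psi>. form n p x = 0) \<longleftrightarrow> (\<forall>p\<in>\<Psi>. 0 \<le> form n p x)" if "x \<in> sublevel n \<Phi>" for x
  proof -
    have "\<forall>p\<in>\<Psi>. form n p x \<le> 0"
      using that assms unfolding sublevel_def by blast
    then show ?thesis by (auto intro!: antisym)
  qed
  then show ?thesis
    by (auto simp: sublevel_def affine_form_uminus ball_Un)
qed

lemma polyhedral_set_empty: "0 < n \<Longrightarrow> polyhedral_set n {}"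
  using polyhedral_set_sublevel [of n "{(\<lambda>_. 0, 1)}"] by (simp add: sublevel_def affine_form_def)

lemma polyhedral_set_face:
  assumes "0 < n" "polyhedral_set n P" "is_face n Q P"
  shows "polyhedral_set n Q"
proof -
  obtain \<Phi> where \<Phi>: "finite \<Phi>" "P = sublevel n \<Phi>"
    using assms by (auto simp: polyhedral_set_iff_sublevel)
  show ?thesis
  proof (cases "Q = {}")
    case True
    then show ?thesis using assms(1) polyhedral_set_empty by simp
  next
    case False
    then obtain \<Psi> where "\<Psi> \<subseteq> \<Phi>" "Q = {x \<in> sublevel n \<Phi>. \<forall>p\<in>\<Psi>. form n p x = 0}"
      using assms(3) \<Phi> by (auto simp: is_face_sublevel_iff)
    then show ?thesis
      using \<Phi>(1) assms(1) finite_subset [of \<Psi> \<Phi>] by (simp add: face_sublevel polyhedral_set_sublevel)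
  qed
qed

text \<open>\<open>Q\<close> is presented by \<open>\<Phi>\<close> and the negated forms of
  \<open>\<Psi>\<close>. Among the equations \<open>\<Theta>\<close> cutting \<open>R\<close> out of
  \<open>Q\<close>, the negated ones hold on \<open>Q\<close> anyway; hence \<open>R\<close> is cut
  out of \<open>P\<close> by \<open>\<Psi>\<close> and
  \<open>\<Theta> \<inter> \<Phi>\<close>.\<close>

lemma is_face_trans:
  assumes "0 < n" "polyhedral_set n P" "is_face n Q P" "is_face n R Q"
  shows "is_face n R P"
proof (cases "R = {}")
  case False
  obtain \<Phi> where \<Phi>: "finite \<Phi>" "P = sublevel n \<Phi>"
    using assms by (auto simp: polyhedral_set_iff_sublevel)
  have "Q \<noteq> {}" using False assms(4) is_face_subset by fastforce
  then obtain \<Psi> where \<Psi>: "\<Psi> \<subseteq> \<Phi>" "Q = {x \<in> sublevel n \<Phi>. \<forall>p\<in>\<Psi>. form n p x = 0}"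
    using assms(3) \<Phi> by (auto simp: is_face_sublevel_iff)
  define \<Phi>' where "\<Phi>' = \<Phi> \<union> (\<lambda>p. (\<lambda>k. - fst p k, - snd p)) ` \<Psi>"
  have Q: "Q = sublevel n \<Phi>'"
    using face_sublevel [OF \<Psi>(1)] \<Psi>(2) by (simp add: \<Phi>'_def)
  have "finite \<Phi>'" using \<Phi>(1) \<Psi>(1) finite_subset by (auto simp: \<Phi>'_def)
  then obtain \<Theta> where \<Theta>: "\<Theta> \<subseteq> \<Phi>'" "R = {x \<in> Q. \<forall>p\<in>\<Theta>. form n p x = 0}"
    using assms(4) False unfolding Q by (auto simp: is_face_sublevel_iff)
  have "R = {x \<in> P. \<forall>p\<in>\<Psi> \<union> (\<Theta> \<inter> \<Phi>). form n p x = 0}"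
  proof -
    have "(\<forall>p\<in>\<Theta>. form n p x = 0) \<longleftrightarrow> (\<forall>p\<in>\<Theta> \<inter> \<Phi>. form n p x = 0)"
      if "\<forall>p\<in>\<Psi>. form n p x = 0" for x
      using that \<Theta>(1) unfolding \<Phi>'_def by (fastforce simp: affine_form_uminus)
    then show ?thesis unfolding \<Theta>(2) \<Psi>(2) \<Phi>(2) by blast
  qed
  moreover have "\<Psi> \<union> (\<Theta> \<inter> \<Phi>) \<subseteq> \<Phi>" using \<Psi>(1) by blast
  ultimately show ?thesis
    unfolding \<Phi>(2) is_face_sublevel_iff [OF \<Phi>(1)] by blast
qed (simp add: is_face_def)


section \<open>Hyperplane arrangements\<close>

definition hyperplanes :: "nat \<Rightarrow> ((nat \<Rightarrow> real) \<times> real) set \<Rightarrow> (nat \<Rightarrow> real) set set" where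
  "hyperplanes n F = (\<lambda>p. zero_set n (fst p) (snd p)) ` F"

definition generic_points :: "nat \<Rightarrow> ((nat \<Rightarrow> real) \<times> real) set \<Rightarrow> (nat \<Rightarrow> real) set" where
  "generic_points n F = {y \<in> Rn n. \<forall>p\<in>F. form n p y \<noteq> 0}"

text \<open>For generic \<open>y\<close> the product condition says that each form either vanishes
  at \<open>x\<close> or has the same sign there as at \<open>y\<close>.\<close>

definition sign_cell :: "nat \<Rightarrow> ((nat \<Rightarrow> real) \<times> real) set \<Rightarrow> (nat \<Rightarrow> real) \<Rightarrow> (nat \<Rightarrow> real) set" where
  "sign_cell n F y = {x \<in> Rn n. \<forall>p\<in>F. 0 \<le> form n p x * form n p y}"

definition open_sign_cell ::
    "nat \<Rightarrow> ((nat \<Rightarrow> real) \<times> real) set \<Rightarrow> (nat \<Rightarrow> real) \<Rightarrow> (nat \<Rightarrow> real) set" where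
  "open_sign_cell n F y = {x \<in> Rn n. \<forall>p\<in>F. 0 < form n p x * form n p y}"

text \<open>With the value at \<open>y\<close> held fixed, each product is an affine form in
  \<open>x\<close>, up to sign one of the listed inequalities.\<close>

lemma sign_cell_eq_sublevel:
  "sign_cell n F y =
     sublevel n ((\<lambda>p. (\<lambda>k. - form n p y * fst p k, - form n p y * snd p)) ` F)"
  unfolding sign_cell_def sublevel_def
  by (simp only: ball_simps fst_conv snd_conv affine_form_scale) (simp add: mult.commute)

section \<open>Closures and connected components of sign cells\<close>

lemma closedin_sublevel: "closedin (Euclidean_space n) (sublevel n \<Phi>)"
proof -
  have "closedin (Euclidean_space n) {x \<in> Rn n. form n p x \<in> {..0}}" for p
    by (intro closedin_continuous_map_preimage [OF continuous_map_affine_form]) simp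
  moreover have "sublevel n \<Phi> =
      \<Inter>(insert (Rn n) ((\<lambda>p. {x \<in> Rn n. form n p x \<in> {..0}}) ` \<Phi>))"
    by (auto simp: sublevel_def)
  ultimately show ?thesis
    by (simp only:) (intro closedin_Inter; auto)
qed

text \<open>The contribution of \<open>x\<close> to the product is nonnegative, while that of
  \<open>y\<close> is a positive multiple of a nonzero square.\<close>

lemma line_in_open_sign_cell:
  assumes "x \<in> sign_cell n F y" "y \<in> generic_points n F" "0 < t" "t \<le> 1"
  shows "(\<lambda>i. (1 - t) * x i + t * y i) \<in> open_sign_cell n F y"
proof -
  have "0 < ((1 - t) * form n p x + t * form n p y) * form n p y" if "p \<in> F" for p
  proof -
    have "0 \<le> (1 - t) * (form n p x * form n p y)"
      using assms(1,4) that unfolding sign_cell_def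
      by (intro mult_nonneg_nonneg [of "1 - t"]) auto
    moreover have "0 < t * (form n p y * form n p y)"
      using assms that by (auto simp: generic_points_def zero_less_mult_iff)
    ultimately show ?thesis by (simp add: algebra_simps)
  qed
  moreover have "x \<in> Rn n" "y \<in> Rn n"
    using assms by (auto simp: sign_cell_def generic_points_def)
  ultimately show ?thesis
    using Rn_line unfolding open_sign_cell_def by (simp add: affine_form_line)
qed

lemma open_sign_cell_subset: "open_sign_cell n F y \<subseteq> sign_cell n F y"
  unfolding open_sign_cell_def sign_cell_def using order_less_imp_le by blast

lemma closure_of_open_sign_cell:
  assumes y: "y \<in> generic_points n F"
  shows "Euclidean_space n closure_of open_sign_cell n F y = sign_cell n F y"
proof
  show "Euclidean_space n closure_of open_sign_cell n F y \<subseteq> sign_cell n F y"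
    by (intro closure_of_minimal open_sign_cell_subset)
      (simp only: sign_cell_eq_sublevel closedin_sublevel)
  show "sign_cell n F y \<subseteq> Euclidean_space n closure_of open_sign_cell n F y"
  proof
    fix x assume x: "x \<in> sign_cell n F y"
    define l where "l = (\<lambda>(t::real) i. (1 - t) * x i + t * y i)"
    have "x \<in> Rn n" "y \<in> Rn n"
      using x y by (auto simp: sign_cell_def generic_points_def)
    then have "continuous_map euclideanreal (Euclidean_space n) l"
      unfolding l_def by (rule continuous_map_line)
    \<comment> \<open>The limit is taken in the parameter: \<open>0\<close> lies in the closure of
      \<open>{0<..1}\<close>, and \<open>l 0 = x\<close>.\<close>
    then have "l ` closure {0<..1} \<subseteq> Euclidean_space n closure_of (l ` {0<..1})"
      using continuous_map_image_closure_subset by fastforce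
    also have "\<dots> \<subseteq> Euclidean_space n closure_of open_sign_cell n F y"
      by (intro closure_of_mono) (auto simp: l_def intro!: line_in_open_sign_cell [OF x y])
    finally have "l 0 \<in> Euclidean_space n closure_of open_sign_cell n F y"
      by (auto simp: image_subset_iff)
    then show "x \<in> Euclidean_space n closure_of open_sign_cell n F y"
      by (simp add: l_def)
  qed
qed

lemma generic_points_eq: "generic_points n F = Rn n - \<Union>(hyperplanes n F)"
  by (auto simp: generic_points_def hyperplanes_def zero_set_def)

text \<open>By the intermediate value theorem no form changes sign on a connected set that avoids
  its zeros. Conversely, the segment from a point of the open cell to \<open>y\<close> stays inside
  the cell.\<close>

lemma connected_component_generic_points:
  assumes y: "y \<in> generic_points n F"
  shows "connected_component_of_set (subtopology (Euclidean_space n) (generic_points n F)) y =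
    open_sign_cell n F y" (is "connected_component_of_set ?E y = _")
proof
  show "connected_component_of_set ?E y \<subseteq> open_sign_cell n F y"
  proof
    fix x assume "x \<in> connected_component_of_set ?E y"
    then obtain T where T: "connectedin ?E T" "y \<in> T" "x \<in> T"
      by (auto simp: connected_component_of_def)
    then have TF: "T \<subseteq> generic_points n F" and Tc: "connectedin (Euclidean_space n) T"
      by (auto simp: connectedin_subtopology)
    have "0 < form n p x * form n p y" if "p \<in> F" for p
    proof (rule ccontr)
      assume "\<not> 0 < form n p x * form n p y"
      then have "form n p x \<le> 0 \<and> 0 \<le> form n p y \<or> form n p y \<le> 0 \<and> 0 \<le> form n p x"
        by (auto simp: not_less mult_le_0_iff)
      moreover have "connected (form n p ` T)"
        using connectedin_continuous_map_image [OF continuous_map_affine_form Tc]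
        by (simp add: connectedin_iff_connected)
      ultimately have "0 \<in> form n p ` T"
        using T(2,3) by (meson connected_contains_Icc atLeastAtMost_iff image_eqI subsetD)
      then show False using TF that by (auto simp: generic_points_def)
    qed
    then show "x \<in> open_sign_cell n F y"
      using T TF by (auto simp: open_sign_cell_def generic_points_def)
  qed
  show "open_sign_cell n F y \<subseteq> connected_component_of_set ?E y"
  proof
    fix x assume x: "x \<in> open_sign_cell n F y"
    define l where "l = (\<lambda>(t::real) i. (1 - t) * x i + t * y i)"
    have xy: "x \<in> Rn n" "y \<in> Rn n"
      using x y by (auto simp: open_sign_cell_def generic_points_def)
    then have "continuous_map euclideanreal (Euclidean_space n) l"
      unfolding l_def by (rule continuous_map_line)
    then have "connectedin (Euclidean_space n) (l ` {0..1})"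
      by (rule connectedin_continuous_map_image) simp
    moreover have "l t \<in> open_sign_cell n F y" if "t \<in> {0..1}" for t
    proof (cases "t = 0")
      case True
      then show ?thesis using x by (simp add: l_def)
    next
      case False
      then show ?thesis
        using that x y open_sign_cell_subset unfolding l_def
        by (intro line_in_open_sign_cell) auto
    qed
    then have "l ` {0..1} \<subseteq> generic_points n F"
      by (fastforce simp: open_sign_cell_def generic_points_def)
    ultimately have "connectedin ?E (l ` {0..1})"
      by (simp add: connectedin_subtopology)
    moreover have "l 0 \<in> l ` {0..1}" "l 1 \<in> l ` {0..1}" by auto
    moreover have "l 0 = x" "l 1 = y" by (simp_all add: l_def)
    ultimately show "x \<in> connected_component_of_set ?E y"
      unfolding connected_component_of_def by auto
  qed
qed

lemma arrangement_top_cells_eq: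
  "arrangement_top_cells n (hyperplanes n F) = sign_cell n F ` generic_points n F"
proof -
  have "topspace (subtopology (Euclidean_space n) (generic_points n F)) = generic_points n F"
    by (auto simp: generic_points_def)
  then show ?thesis
    unfolding arrangement_top_cells_def generic_points_eq [symmetric] connected_components_of_def
    by (simp add: image_image connected_component_generic_points closure_of_open_sign_cell
        cong: image_cong)
qed

text \<open>Move from \<open>x\<close> in the direction of a point \<open>(1, t, t\<^sup>2, \<dots>)\<close> of the moment curve that avoids
  the linear parts of all forms.\<close>

lemma sign_cells_cover:
  assumes F: "finite F" "\<And>p. p \<in> F \<Longrightarrow> nonzero_vec n (fst p)" and x: "x \<in> Rn n"
  obtains y where "y \<in> generic_points n F" "x \<in> sign_cell n F y"
proof -
  \<comment> \<open>\<open>g p t\<close> is the linear part of \<open>p\<close> at the moment curve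
    point with parameter \<open>t\<close>. As a nonzero polynomial in \<open>t\<close> it has
    finitely many roots, so some \<open>t\<close> avoids the roots for all of
    \<open>F\<close>.\<close>
  define g where "g = (\<lambda>(p :: (nat \<Rightarrow> real) \<times> real) t. \<Sum>k<n. fst p k * t ^ k)"
  have "finite {t. g p t = 0}" if p: "p \<in> F" for p
  proof -
    obtain k where k: "k < n" "fst p k \<noteq> 0"
      using F(2) [OF p] by (auto simp: nonzero_vec_def)
    then have "{..<n} = {..n - 1}" by auto
    then show ?thesis
      using k polyfun_finite_roots [of "fst p" "n - 1"] unfolding g_def by force
  qed
  then have "finite (\<Union>p\<in>F. {t. g p t = 0})" using F(1) by blast
  then obtain t where t: "t \<notin> (\<Union>p\<in>F. {t. g p t = 0})"
    using ex_new_if_finite [OF infinite_UNIV_char_0] by blast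
  \<comment> \<open>A step of small length \<open>s\<close> preserves the sign of every form that is
    nonzero at \<open>x\<close>; the forms vanishing at \<open>x\<close> become nonzero because
    \<open>g p t\<close> is.\<close>
  have "\<forall>\<^sub>F s in at_right 0. form n p x = 0 \<or> \<bar>s * g p t\<bar> < \<bar>form n p x\<bar>" for p
  proof (cases "form n p x = 0")
    case False
    have "((\<lambda>s. \<bar>s * g p t\<bar>) \<longlongrightarrow> \<bar>0 * g p t\<bar>) (at_right 0)"
      by (intro tendsto_intros)
    then have "\<forall>\<^sub>F s in at_right 0. \<bar>s * g p t\<bar> < \<bar>form n p x\<bar>"
      using False by (intro order_tendstoD(2)) auto
    then show ?thesis by eventually_elim simp
  qed simp
  then have "\<forall>\<^sub>F s in at_right 0. \<forall>p\<in>F. form n p x = 0 \<or> \<bar>s * g p t\<bar> < \<bar>form n p x\<bar>"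
    using F(1) by (intro eventually_ball_finite) auto
  then have "\<forall>\<^sub>F s::real in at_right 0.
      0 < s \<and> (\<forall>p\<in>F. form n p x = 0 \<or> \<bar>s * g p t\<bar> < \<bar>form n p x\<bar>)"
    using eventually_at_right_less by eventually_elim simp
  then obtain s where s: "0 < s" "\<forall>p\<in>F. form n p x = 0 \<or> \<bar>s * g p t\<bar> < \<bar>form n p x\<bar>"
    using eventually_happens' [OF trivial_limit_at_right_real] by blast
  define y where "y = (\<lambda>i. if i < n then x i + s * t ^ i else 0)"
  have y: "form n p y = form n p x + s * g p t" for p
    by (simp add: affine_form_def y_def g_def algebra_simps sum.distrib sum_distrib_left)
  have "form n p y \<noteq> 0 \<and> 0 \<le> form n p x * form n p y" if p: "p \<in> F" for p
  proof (cases "form n p x = 0")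
    case True
    then show ?thesis using s(1) t p by (auto simp: y)
  next
    case False
    then have "\<bar>s * g p t\<bar> < \<bar>form n p x\<bar>" using s(2) p by blast
    then show ?thesis unfolding y zero_le_mult_iff by linarith
  qed
  moreover have "y \<in> Rn n" by (simp add: y_def topspace_Euclidean_space)
  ultimately show thesis
    using x by (intro that [of y]) (auto simp: generic_points_def sign_cell_def)
qed

section \<open>Sign cells and their faces as a polyhedral decomposition\<close>

lemma finite_sign_cells:
  assumes "finite F"
  shows "finite (sign_cell n F ` generic_points n F)"
proof -
  \<comment> \<open>A generic point enters its sign cell only through the set of forms positive at
    it, and \<open>F\<close> has finitely many subsets.\<close>
  define h where "h = (\<lambda>S. {x \<in> Rn n. (\<forall>p\<in>S. 0 \<le> form n p x) \<and> (\<forall>p\<in>F - S. form n p x \<le> 0)})"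
  have "sign_cell n F y = h {p \<in> F. 0 < form n p y}" if "y \<in> generic_points n F" for y
  proof -
    have "0 \<le> form n p x * form n p y \<longleftrightarrow>
        (if 0 < form n p y then 0 \<le> form n p x else form n p x \<le> 0)" if "p \<in> F" for p x
      using that \<open>y \<in> generic_points n F\<close> by (auto simp: generic_points_def zero_le_mult_iff)
    then show ?thesis unfolding sign_cell_def h_def by auto
  qed
  then have "sign_cell n F ` generic_points n F \<subseteq> h ` Pow F" by blast
  then show ?thesis using assms finite_surj [of "Pow F"] by blast
qed

lemma finite_faces:
  assumes "0 < n" "polyhedral_set n P"
  shows "finite {Q. is_face n Q P}"
proof -
  obtain \<Phi> where \<Phi>: "finite \<Phi>" "P = sublevel n \<Phi>"
    using assms by (auto simp: polyhedral_set_iff_sublevel)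
  have "{Q. is_face n Q P} \<subseteq> insert {} ((\<lambda>\<Psi>. {x \<in> P. \<forall>p\<in>\<Psi>. form n p x = 0}) ` Pow \<Phi>)"
    unfolding \<Phi>(2) is_face_sublevel_iff [OF \<Phi>(1)] by auto
  then show ?thesis using \<Phi>(1) finite_subset by fastforce
qed

lemma polyhedral_set_sign_cell:
  "\<lbrakk>0 < n; finite F\<rbrakk> \<Longrightarrow> polyhedral_set n (sign_cell n F y)"
  by (simp add: sign_cell_eq_sublevel polyhedral_set_sublevel)

lemma sign_cell_single_signed:
  "p \<in> F \<Longrightarrow> y \<in> generic_points n F \<Longrightarrow>
    (\<forall>x\<in>sign_cell n F y. form n p x \<le> 0) \<or> (\<forall>x\<in>sign_cell n F y. 0 \<le> form n p x)"
  by (auto simp: generic_points_def sign_cell_def zero_le_mult_iff)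
   fastforce

text \<open>\<open>D\<close> collects the forms that separate \<open>y\<close> from
  \<open>z\<close>. On the cell of \<open>y\<close>, such a form satisfies the sign condition of
  \<open>z\<close> only by vanishing; for the other forms the two conditions coincide.\<close>

lemma is_face_sign_cell_Int:
  assumes "finite F" and y: "y \<in> generic_points n F" and z: "z \<in> generic_points n F"
  shows "is_face n (sign_cell n F y \<inter> sign_cell n F z) (sign_cell n F y)"
proof -
  define D where "D = {p \<in> F. form n p y * form n p z < 0}"
  have "x \<in> sign_cell n F z \<longleftrightarrow> (\<forall>p\<in>D. form n p x = 0)" if x: "x \<in> sign_cell n F y" for x
  proof -
    have "0 \<le> form n p x * form n p z \<longleftrightarrow> (form n p y * form n p z < 0 \<longrightarrow> form n p x = 0)"
      if "p \<in> F" for p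
    proof -
      have "0 \<le> form n p x * form n p y" "form n p y \<noteq> 0" "form n p z \<noteq> 0"
        using that x y z by (auto simp: sign_cell_def generic_points_def)
      then show ?thesis by (auto simp: zero_le_mult_iff mult_less_0_iff)
    qed
    moreover have "x \<in> Rn n" using x by (simp add: sign_cell_def)
    ultimately show ?thesis by (auto simp: sign_cell_def D_def)
  qed
  then have "sign_cell n F y \<inter> sign_cell n F z = {x \<in> sign_cell n F y. \<forall>p\<in>D. form n p x = 0}"
    by blast
  moreover have "is_face n {x \<in> sign_cell n F y. \<forall>p\<in>D. form n p x = 0} (sign_cell n F y)"
  proof (rule is_face_tight)
    show "finite D" using assms(1) by (simp add: D_def)
    show "sign_cell n F y \<subseteq> Rn n" by (auto simp: sign_cell_def)
  qed (use sign_cell_single_signed y in \<open>auto simp: D_def\<close>)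
  ultimately show ?thesis by simp
qed

lemma arrangement_complex_eq:
  "arrangement_complex n (hyperplanes n F) =
     {Q. \<exists>y\<in>generic_points n F. is_face n Q (sign_cell n F y)}"
  by (auto simp: arrangement_complex_def arrangement_top_cells_eq)

lemma polyhedral_complex_arrangement_complex:
  assumes n: "0 < n" and F: "finite F"
  shows "polyhedral_complex n (arrangement_complex n (hyperplanes n F))"
    (is "polyhedral_complex n ?M")
proof -
  note P = polyhedral_set_sign_cell [OF n F]
  have "?M = (\<Union>C\<in>sign_cell n F ` generic_points n F. {Q. is_face n Q C})"
    by (auto simp: arrangement_complex_eq)
  then have "finite ?M"
    using finite_sign_cells [OF F] finite_faces [OF n P] by (simp only:) (intro finite_UN_I; blast)
  moreover have "\<forall>Q\<in>?M. polyhedral_set n Q"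
    using polyhedral_set_face [OF n P] by (auto simp: arrangement_complex_eq)
  moreover have "face_closed n ?M"
    using is_face_trans [OF n P] unfolding face_closed_def arrangement_complex_eq by blast
  moreover have "is_face n (Q \<inter> R) Q" if "Q \<in> ?M" "R \<in> ?M" for Q R
  proof -
    obtain y z where y: "y \<in> generic_points n F" "is_face n Q (sign_cell n F y)"
      and z: "z \<in> generic_points n F" "is_face n R (sign_cell n F z)"
      using \<open>Q \<in> ?M\<close> \<open>R \<in> ?M\<close> by (auto simp: arrangement_complex_eq)
    \<comment> \<open>\<open>C\<close> is a common face of the two sign cells and contains
      \<open>Q \<inter> R\<close>. Both \<open>Q\<close> and \<open>R\<close> cut faces out of
      \<open>C\<close>, so \<open>Q \<inter> R\<close> is a face of \<open>C\<close>, by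
      transitivity of the cell of \<open>y\<close>, and then of the smaller set
      \<open>Q\<close>.\<close>
    define C where "C = sign_cell n F y \<inter> sign_cell n F z"
    have Cy: "is_face n C (sign_cell n F y)" and Cz: "is_face n C (sign_cell n F z)"
      using is_face_sign_cell_Int [OF F y(1) z(1)] is_face_sign_cell_Int [OF F z(1) y(1)]
      by (simp_all add: C_def Int_commute)
    have sub: "sign_cell n F w \<subseteq> Rn n" for w by (auto simp: sign_cell_def)
    then have CR: "C \<subseteq> Rn n" by (auto simp: C_def)
    have "is_face n (Q \<inter> C) C"
      by (rule is_face_mono [OF is_face_Int [OF sub y(2) Cy]]) (auto simp: C_def)
    moreover have "is_face n (R \<inter> C) C"
      by (rule is_face_mono [OF is_face_Int [OF sub z(2) Cz]]) (auto simp: C_def)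
    ultimately have "is_face n ((Q \<inter> C) \<inter> (R \<inter> C)) C"
      by (rule is_face_Int [OF CR])
    moreover have "(Q \<inter> C) \<inter> (R \<inter> C) = Q \<inter> R"
      using is_face_subset [OF y(2)] is_face_subset [OF z(2)] by (auto simp: C_def)
    ultimately have "is_face n (Q \<inter> R) (sign_cell n F y)"
      using is_face_trans [OF n P Cy] by simp
    then show ?thesis
      using is_face_subset [OF y(2)] by (rule is_face_mono [OF _ Int_lower1])
  qed
  ultimately show ?thesis
    unfolding polyhedral_complex_def by (metis Int_commute)
qed

lemma Union_arrangement_complex:
  assumes "finite F" "\<And>p. p \<in> F \<Longrightarrow> nonzero_vec n (fst p)"
  shows "\<Union>(arrangement_complex n (hyperplanes n F)) = Rn n"
proof
  show "\<Union>(arrangement_complex n (hyperplanes n F)) \<subseteq> Rn n"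
    using is_face_subset by (fastforce simp: arrangement_complex_eq sign_cell_def)
  show "Rn n \<subseteq> \<Union>(arrangement_complex n (hyperplanes n F))"
  proof
    fix x assume "x \<in> Rn n"
    then obtain y where "y \<in> generic_points n F" "x \<in> sign_cell n F y"
      using sign_cells_cover [OF assms] by blast
    then show "x \<in> \<Union>(arrangement_complex n (hyperplanes n F))"
      using is_face_refl by (auto simp: arrangement_complex_eq)
  qed
qed

text \<open>The form defining \<open>H\<close> has constant sign on a sign cell around
  \<open>x\<close>, so its zero locus in that cell is a face. Hence each hyperplane is a union of
  cells, as the subcomplex claim requires.\<close>

lemma hyperplane_cell:
  assumes "finite F" "\<And>p. p \<in> F \<Longrightarrow> nonzero_vec n (fst p)"
    and "H \<in> hyperplanes n F" "x \<in> H"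
  obtains C where "C \<in> arrangement_complex n (hyperplanes n F)" "x \<in> C" "C \<subseteq> H"
proof -
  obtain p where p: "p \<in> F" "H = zero_set n (fst p) (snd p)"
    using assms(3) by (auto simp: hyperplanes_def)
  have "x \<in> Rn n" using assms(4) p by (simp add: zero_set_def)
  then obtain y where y: "y \<in> generic_points n F" "x \<in> sign_cell n F y"
    using sign_cells_cover [OF assms(1,2)] by blast
  have "is_face n {x \<in> sign_cell n F y. \<forall>q\<in>{p}. form n q x = 0} (sign_cell n F y)"
    by (rule is_face_tight) (use sign_cell_single_signed p(1) y(1) in \<open>auto simp: sign_cell_def\<close>)
  then show thesis
    using that y p(2) assms(4) by (auto simp: arrangement_complex_eq zero_set_def sign_cell_def)
qed


section \<open>Level set complexes\<close>

definition pullback ::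
    "nat \<Rightarrow> (nat \<Rightarrow> nat \<Rightarrow> real) \<Rightarrow> (nat \<Rightarrow> real) \<Rightarrow> (nat \<Rightarrow> real) \<times> real \<Rightarrow> (nat \<Rightarrow> real) \<times> real"
  where "pullback r V d p = (\<lambda>k. \<Sum>j<r. fst p j * V j k, (\<Sum>j<r. fst p j * d j) + snd p)"

lemma form_pullback: "form n (pullback r V d p) x = form r p (affine_map n r V d x)"
  by (simp add: pullback_def affine_form_affine_map)

lemma is_face_preimage:
  assumes S: "S \<subseteq> Rn n" and Y: "Y \<subseteq> Rn r" and f: "\<And>x. x \<in> S \<Longrightarrow> f x = affine_map n r V d x"
    and S': "is_face n S' S" and Y': "is_face r Y' Y"
  shows "is_face n (S' \<inter> f -` Y') (S \<inter> f -` Y)"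
proof (cases "S' = {} \<or> Y' = {}")
  case True
  then show ?thesis by (auto simp: is_face_def)
next
  case False
  let ?T = "S \<inter> f -` Y"
  have T: "?T \<subseteq> Rn n" using S by blast
  obtain p q where p: "\<forall>x\<in>S. form n p x \<le> 0" "S' = {x \<in> S. form n p x = 0}"
    and q: "\<forall>y\<in>Y. form r q y \<le> 0" "Y' = {y \<in> Y. form r q y = 0}"
    using S' Y' False unfolding is_face_iff_form [OF S] is_face_iff_form [OF Y] by blast
  have fq: "form n (pullback r V d q) x = form r q (f x)" if "x \<in> S" for x
    by (simp add: form_pullback f that)
  have "is_face n (S' \<inter> f -` Y) ?T"
    unfolding is_face_iff_form [OF T] using p by (intro disjI2 exI [of _ p]) auto
  moreover have "is_face n (S \<inter> f -` Y') ?T"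
    unfolding is_face_iff_form [OF T] using q
    by (intro disjI2 exI [of _ "pullback r V d q"]) (auto simp: fq)
  ultimately have "is_face n ((S' \<inter> f -` Y) \<inter> (S \<inter> f -` Y')) ?T"
    by (rule is_face_Int [OF T])
  moreover have "(S' \<inter> f -` Y) \<inter> (S \<inter> f -` Y') = S' \<inter> f -` Y'"
    using p(2) q(2) by blast
  ultimately show ?thesis by simp
qed

lemma sublevel_preimage:
  assumes "\<And>x. x \<in> sublevel n \<Phi> \<Longrightarrow> f x = affine_map n r V d x"
  shows "sublevel n \<Phi> \<inter> f -` sublevel r \<Psi> = sublevel n (\<Phi> \<union> pullback r V d ` \<Psi>)"
  using assms by (auto simp: sublevel_def form_pullback affine_map_in_Rn ball_Un)

text \<open>Converse to \<open>is_face_preimage\<close>. The equations cutting out \<open>Q\<close>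
  are split by origin: those from \<open>\<Phi>\<close> define \<open>S'\<close>, the pulled back
  ones define \<open>Y'\<close>. A form of both origins is merely imposed twice.\<close>

lemma face_of_preimage:
  assumes n: "0 < n" and r: "0 < r" and S: "polyhedral_set n S" and Y: "polyhedral_set r Y"
    and f: "\<And>x. x \<in> S \<Longrightarrow> f x = affine_map n r V d x"
    and Q: "is_face n Q (S \<inter> f -` Y)"
  obtains S' Y' where "is_face n S' S" "is_face r Y' Y" "Q = S' \<inter> f -` Y'"
proof (cases "Q = {}")
  case True
  then show thesis by (intro that [of "{}" "{}"]) (auto simp: is_face_def)
next
  case False
  obtain \<Phi> \<Psi> where \<Phi>: "finite \<Phi>" "S = sublevel n \<Phi>" and \<Psi>: "finite \<Psi>" "Y = sublevel r \<Psi>"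
    using S Y n r by (auto simp: polyhedral_set_iff_sublevel)
  have T: "S \<inter> f -` Y = sublevel n (\<Phi> \<union> pullback r V d ` \<Psi>)"
    using f unfolding \<Phi>(2) \<Psi>(2) by (rule sublevel_preimage)
  have "finite (\<Phi> \<union> pullback r V d ` \<Psi>)" using \<Phi>(1) \<Psi>(1) by simp
  then obtain \<Theta> where \<Theta>: "\<Theta> \<subseteq> \<Phi> \<union> pullback r V d ` \<Psi>"
    "Q = {x \<in> S \<inter> f -` Y. \<forall>p\<in>\<Theta>. form n p x = 0}"
    using Q False unfolding T by (auto simp: is_face_sublevel_iff)
  define \<Psi>' where "\<Psi>' = {p \<in> \<Psi>. pullback r V d p \<in> \<Theta>}"
  have eq: "\<Theta> = (\<Theta> \<inter> \<Phi>) \<union> pullback r V d ` \<Psi>'"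
    using \<Theta>(1) by (auto simp: \<Psi>'_def)
  have "(\<forall>p\<in>\<Theta>. form n p x = 0) \<longleftrightarrow>
      (\<forall>p\<in>\<Theta> \<inter> \<Phi>. form n p x = 0) \<and> (\<forall>p\<in>\<Psi>'. form r p (f x) = 0)" if "x \<in> S" for x
    by (subst eq) (simp add: ball_Un form_pullback f that)
  then have "Q = {x \<in> S. \<forall>p\<in>\<Theta> \<inter> \<Phi>. form n p x = 0} \<inter> f -` {y \<in> Y. \<forall>p\<in>\<Psi>'. form r p y = 0}"
    unfolding \<Theta>(2) by auto
  moreover have "is_face n {x \<in> S. \<forall>p\<in>\<Theta> \<inter> \<Phi>. form n p x = 0} S"
    unfolding \<Phi>(2) is_face_sublevel_iff [OF \<Phi>(1)] by blast
  moreover have "is_face r {y \<in> Y. \<forall>p\<in>\<Psi>'. form r p y = 0} Y"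
    unfolding \<Psi>(2) is_face_sublevel_iff [OF \<Psi>(1)] \<Psi>'_def by blast
  ultimately show thesis by (rule that [rotated 2])
qed

lemma polyhedral_set_subset_Rn: "polyhedral_set n P \<Longrightarrow> P \<subseteq> Rn n"
  by (auto simp: polyhedral_set_def)

text \<open>Closure under faces comes from \<open>face_of_preimage\<close>, the intersection
  property from \<open>is_face_preimage\<close>. For \<open>T \<inter> T'\<close> as a face of
  \<open>T\<close>, the affine formula on the cell \<open>S\<close> of \<open>T\<close> suffices;
  the other half follows by symmetry.\<close>

lemma polyhedral_complex_level_set_complex:
  assumes n: "0 < n" and r: "0 < r" and M: "polyhedral_complex n M" and R: "polyhedral_complex r R"
    and f: "affine_linear_on_cells n r f M"
  shows "polyhedral_complex n (level_set_complex M f R)" (is "polyhedral_complex n ?L")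
proof -
  have L: "\<exists>S Y. S \<in> M \<and> Y \<in> R \<and> T = S \<inter> f -` Y" if "T \<in> ?L" for T
    using that by (auto simp: level_set_complex_def)
  have LI: "S \<inter> f -` Y \<in> ?L" if "S \<in> M" "Y \<in> R" for S Y
    using that by (auto simp: level_set_complex_def)
  have MP: "polyhedral_set n S" "\<exists>V d. \<forall>x\<in>S. f x = affine_map n r V d x" if "S \<in> M" for S
    using that M f by (auto simp: polyhedral_complex_def affine_linear_on_cells_def)
  have RP: "polyhedral_set r Y" if "Y \<in> R" for Y
    using that R by (auto simp: polyhedral_complex_def)
  have "?L = (\<lambda>(S, Y). S \<inter> f -` Y) ` (M \<times> R)"
    by (auto simp: level_set_complex_def)
  then have "finite ?L"
    using M R by (simp add: polyhedral_complex_def)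
  moreover have "polyhedral_set n T" if "T \<in> ?L" for T
  proof -
    obtain S Y where SY: "S \<in> M" "Y \<in> R" "T = S \<inter> f -` Y" using L \<open>T \<in> ?L\<close> by blast
    obtain V d where f': "\<And>x. x \<in> S \<Longrightarrow> f x = affine_map n r V d x"
      using MP(2) [OF SY(1)] by blast
    obtain \<Phi> \<Psi> where \<Phi>: "finite \<Phi>" "S = sublevel n \<Phi>" and \<Psi>: "finite \<Psi>" "Y = sublevel r \<Psi>"
      using MP(1) [OF SY(1)] RP [OF SY(2)] n r by (auto simp: polyhedral_set_iff_sublevel)
    have "T = sublevel n (\<Phi> \<union> pullback r V d ` \<Psi>)"
      using f' unfolding SY(3) \<Phi>(2) \<Psi>(2) by (rule sublevel_preimage)
    then show ?thesis using n \<Phi>(1) \<Psi>(1) by (simp add: polyhedral_set_sublevel)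
  qed
  moreover have "face_closed n ?L"
    unfolding face_closed_def
  proof (intro ballI allI impI)
    fix T Q assume T: "T \<in> ?L" and Q: "is_face n Q T"
    obtain S Y where SY: "S \<in> M" "Y \<in> R" "T = S \<inter> f -` Y" using L T by blast
    obtain V d where f': "\<And>x. x \<in> S \<Longrightarrow> f x = affine_map n r V d x"
      using MP(2) [OF SY(1)] by blast
    obtain S' Y' where "is_face n S' S" "is_face r Y' Y" "Q = S' \<inter> f -` Y'"
      using face_of_preimage [OF n r MP(1) [OF SY(1)] RP [OF SY(2)] f'] Q SY(3) by metis
    moreover from this have "S' \<in> M" "Y' \<in> R"
      using M R SY(1,2) by (auto simp: polyhedral_complex_def face_closed_def)
    ultimately show "Q \<in> ?L" using LI by blast
  qed
  moreover have "is_face n (T \<inter> T') T" if "T \<in> ?L" "T' \<in> ?L" for T T'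
  proof -
    obtain S Y where SY: "S \<in> M" "Y \<in> R" "T = S \<inter> f -` Y" using L \<open>T \<in> ?L\<close> by blast
    obtain S' Y' where SY': "S' \<in> M" "Y' \<in> R" "T' = S' \<inter> f -` Y'" using L \<open>T' \<in> ?L\<close> by blast
    obtain V d where f': "\<And>x. x \<in> S \<Longrightarrow> f x = affine_map n r V d x"
      using MP(2) [OF SY(1)] by blast
    have "is_face n (S \<inter> S') S" "is_face r (Y \<inter> Y') Y"
      using M R SY SY' by (auto simp: polyhedral_complex_def)
    then have "is_face n ((S \<inter> S') \<inter> f -` (Y \<inter> Y')) (S \<inter> f -` Y)"
      using is_face_preimage polyhedral_set_subset_Rn MP(1) RP SY f' by metis
    moreover have "(S \<inter> S') \<inter> f -` (Y \<inter> Y') = T \<inter> T'"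
      using SY SY' by auto
    ultimately show ?thesis using SY by simp
  qed
  ultimately show ?thesis
    unfolding polyhedral_complex_def by (metis Int_commute)
qed

lemma Union_level_set_complex: "\<Union>(level_set_complex M f R) = \<Union>M \<inter> f -` \<Union>R"
  by (auto simp: level_set_complex_def)


section \<open>ReLU networks\<close>

text \<open>A hyperplane does not remember the sign of its form. Keeping the rows as forms lets sign
  cells record which neurons are active.\<close>

definition layer_forms ::
    "(nat \<Rightarrow> nat) \<Rightarrow> weights \<Rightarrow> biases \<Rightarrow> nat \<Rightarrow> ((nat \<Rightarrow> real) \<times> real) set" where
  "layer_forms n W b i = {(W i j, b i j) | j. j < n i \<and> nonzero_vec (n (i - 1)) (W i j)}"

lemma finite_layer_forms: "finite (layer_forms n W b i)"
proof -
  have "layer_forms n W b i \<subseteq> (\<lambda>j. (W i j, b i j)) ` {..<n i}"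
    by (auto simp: layer_forms_def)
  then show ?thesis using finite_subset by blast
qed

lemma nonzero_vec_layer_forms:
  "p \<in> layer_forms n W b i \<Longrightarrow> nonzero_vec (n (i - 1)) (fst p)"
  by (auto simp: layer_forms_def)

lemma layer_arrangement_eq:
  "layer_arrangement n W b i = hyperplanes (n (i - 1)) (layer_forms n W b i)"
  by (force simp: layer_arrangement_def hyperplanes_def layer_forms_def image_iff)

lemma polyhedral_decomposition_layer_complex:
  "0 < n (i - 1) \<Longrightarrow> polyhedral_decomposition (n (i - 1)) (layer_complex n W b i)"
  unfolding polyhedral_decomposition_def layer_complex_def layer_arrangement_eq
  using polyhedral_complex_arrangement_complex Union_arrangement_complex
    finite_layer_forms nonzero_vec_layer_forms by metis

lemma layer_hyperplane_cell:
  assumes "H \<in> layer_arrangement n W b i" "x \<in> H"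
  obtains Y where "Y \<in> layer_complex n W b i" "x \<in> Y" "Y \<subseteq> H"
  using hyperplane_cell [of "layer_forms n W b i" "n (i - 1)" H x, OF finite_layer_forms]
    assms nonzero_vec_layer_forms that
  unfolding layer_complex_def layer_arrangement_eq by blast

lemma layer_map_affine_linear_on_cells:
  "affine_linear_on_cells (n (i - 1)) (n i) (layer_map n W b i) (layer_complex n W b i)"
  unfolding affine_linear_on_cells_def
proof
  let ?n = "n (i - 1)" and ?F = "layer_forms n W b i"
  fix S assume "S \<in> layer_complex n W b i"
  then obtain y where y: "y \<in> generic_points ?n ?F" "is_face ?n S (sign_cell ?n ?F y)"
    by (auto simp: layer_complex_def layer_arrangement_eq arrangement_complex_eq)
  \<comment> \<open>Rows active at the generic point \<open>y\<close> are kept and the others set to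
    zero; on the sign cell of \<open>y\<close> this reproduces ReLU.\<close>
  define V where "V = (\<lambda>j k. if 0 < affine_form ?n (W i j) (b i j) y then W i j k else 0)"
  define d where "d = (\<lambda>j. if 0 < affine_form ?n (W i j) (b i j) y then b i j else 0)"
  have "max 0 (affine_form ?n (W i j) (b i j) x) = affine_form ?n (V j) (d j) x"
    if x: "x \<in> S" and j: "j < n i" for x j
  proof -
    \<comment> \<open>The second alternative covers degenerate rows: they give no hyperplane, but
      their forms are constant, so the activity at \<open>y\<close> is still decisive.\<close>
    have "0 \<le> affine_form ?n (W i j) (b i j) x * affine_form ?n (W i j) (b i j) y \<and>
        affine_form ?n (W i j) (b i j) y \<noteq> 0 \<or>
        affine_form ?n (W i j) (b i j) x = affine_form ?n (W i j) (b i j) y"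
    proof (cases "nonzero_vec ?n (W i j)")
      case True
      then have "(W i j, b i j) \<in> ?F" using j by (auto simp: layer_forms_def)
      then show ?thesis
        using y(1) x is_face_subset [OF y(2)]
        by (force simp: generic_points_def sign_cell_def)
    qed (simp add: affine_form_const)
    moreover have "affine_form ?n (\<lambda>k. 0) 0 x = 0" by (simp add: affine_form_def)
    ultimately show ?thesis
      by (auto simp: V_def d_def zero_le_mult_iff)
  qed
  then have "\<forall>x\<in>S. layer_map n W b i x = affine_map ?n (n i) V d x"
    by (auto simp: layer_map_def relu_def layer_affine_def affine_map_def fun_eq_iff)
  then show "\<exists>V c. \<forall>x\<in>S. layer_map n W b i x = affine_map ?n (n i) V c x" by blast
qed

lemma continuous_map_layer_map:
  "continuous_map (Euclidean_space (n (i - 1))) (Euclidean_space (n i)) (layer_map n W b i)"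
proof -
  have "layer_map n W b i =
      (\<lambda>x j. if j < n i then max 0 (affine_form (n (i - 1)) (W i j) (b i j) x) else 0)"
    by (auto simp: layer_map_def relu_def layer_affine_def affine_map_def fun_eq_iff)
  then show ?thesis
    by (simp add: continuous_map_componentwise_Euclidean_space)
      (intro allI impI continuous_intros continuous_map_affine_form)
qed

section \<open>Compositions of layers\<close>

lemma continuous_map_layers_comp:
  "continuous_map (Euclidean_space (n 0)) (Euclidean_space (n i)) (layers_comp n W b i)"
proof (induction i)
  case (Suc i)
  have "continuous_map (Euclidean_space (n i)) (Euclidean_space (n (Suc i))) (layer_map n W b (Suc i))"
    using continuous_map_layer_map [of n "Suc i" W b] by simp
  from continuous_map_compose [OF Suc this] show ?case by (simp add: o_def)
qed (simp add: id_def)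

lemma affine_linear_on_cells_compose:
  assumes "affine_linear_on_cells n r f M" "affine_linear_on_cells r s g R"
  shows "affine_linear_on_cells n s (g \<circ> f) (level_set_complex M f R)"
  unfolding affine_linear_on_cells_def
proof
  fix T assume "T \<in> level_set_complex M f R"
  then obtain S Y where SY: "S \<in> M" "Y \<in> R" "T = S \<inter> f -` Y"
    by (auto simp: level_set_complex_def)
  then obtain V c V' c' where "\<forall>x\<in>S. f x = affine_map n r V c x" "\<forall>y\<in>Y. g y = affine_map r s V' c' y"
    using assms by (metis affine_linear_on_cells_def)
  then have "(g \<circ> f) x = affine_map r s V' c' (affine_map n r V c x)" if "x \<in> T" for x
    using that SY(3) by auto
  then show "\<exists>V c. \<forall>x\<in>T. (g \<circ> f) x = affine_map n s V c x"
    unfolding affine_map_affine_map by blast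
qed

text \<open>Faces lie inside their cell, so containment in \<open>B\<close> passes to them. It then
  remains to see that the cells inside \<open>B\<close> cover it.\<close>

lemma subcomplex_of_subset:
  "face_closed n M \<Longrightarrow> polyhedral_subcomplex n {C \<in> M. C \<subseteq> B} M"
  unfolding polyhedral_subcomplex_def face_closed_def using is_face_subset by blast

lemma layers_complex_properties:
  assumes "1 \<le> i" and "\<forall>k<i. 0 < n k"
  shows "polyhedral_decomposition (n 0) (layers_complex n W b i)"
    and "affine_linear_on_cells (n 0) (n i) (layers_comp n W b i) (layers_complex n W b i)"
    and "\<Union>{C \<in> layers_complex n W b i. C \<subseteq> (\<Union>k\<in>{1..i}. bent_hyperplanes n W b k)} =
      (\<Union>k\<in>{1..i}. bent_hyperplanes n W b k)" (is ?bent)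
proof -
  \<comment> \<open>The claims go through the induction together, the last one pointwise: every
    point of the union of bent hyperplanes lies in a cell contained in that union.\<close>
  have "polyhedral_decomposition (n 0) (layers_complex n W b i) \<and>
    affine_linear_on_cells (n 0) (n i) (layers_comp n W b i) (layers_complex n W b i) \<and>
    (\<forall>x\<in>\<Union>k\<in>{1..i}. bent_hyperplanes n W b k. \<exists>C\<in>layers_complex n W b i.
      x \<in> C \<and> C \<subseteq> (\<Union>k\<in>{1..i}. bent_hyperplanes n W b k))"
    using assms
  proof (induction i rule: nat_induct_at_least)
    case base
    have "bent_hyperplanes n W b 1 = \<Union>(layer_arrangement n W b 1)"
      by (auto simp: bent_hyperplanes_def layer_arrangement_def zero_set_def)
    then have "\<exists>C\<in>layer_complex n W b 1. x \<in> C \<and> C \<subseteq> bent_hyperplanes n W b 1"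
      if "x \<in> bent_hyperplanes n W b 1" for x
      using that layer_hyperplane_cell [of _ n W b 1 x] by (metis Sup_upper2 UnionE)
    then show ?case
      using base polyhedral_decomposition_layer_complex [of n 1 W b]
        layer_map_affine_linear_on_cells [of n 1 W b] by simp
  next
    case (Suc i)
    define M where "M = layers_complex n W b i"
    define R where "R = layer_complex n W b (Suc i)"
    define f where "f = layers_comp n W b i"
    define B where "B = (\<Union>k\<in>{1..i}. bent_hyperplanes n W b k)"
    have B': "(\<Union>k\<in>{1..Suc i}. bent_hyperplanes n W b k) = B \<union> bent_hyperplanes n W b (Suc i)"
      by (auto simp: B_def atLeastAtMostSuc_conv)
    have M': "layers_complex n W b (Suc i) = level_set_complex M f R"
      \<comment> \<open>The recursion for the complex starts at \<open>1\<close>;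
        \<open>1 \<le> i\<close> excludes the unspecified value at \<open>0\<close>.\<close>
      using Suc.hyps by (cases i) (auto simp: M_def f_def R_def)
    have pos: "0 < n 0" "0 < n i" using Suc.prems by auto
    have IH: "polyhedral_decomposition (n 0) M" "affine_linear_on_cells (n 0) (n i) f M"
      "\<And>x. x \<in> B \<Longrightarrow> \<exists>C\<in>M. x \<in> C \<and> C \<subseteq> B"
      using Suc.IH Suc.prems by (auto simp: M_def f_def B_def)
    have R: "polyhedral_decomposition (n i) R"
      "affine_linear_on_cells (n i) (n (Suc i)) (layer_map n W b (Suc i)) R"
      using polyhedral_decomposition_layer_complex [of n "Suc i" W b] pos
        layer_map_affine_linear_on_cells [of n "Suc i" W b] by (auto simp: R_def)
    have f: "f x \<in> Rn (n i)" if "x \<in> Rn (n 0)" for x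
      using continuous_map_layers_comp that unfolding f_def continuous_map_def by blast
    have UM: "\<Union>M = Rn (n 0)" and UR: "\<Union>R = Rn (n i)"
      using IH(1) R(1) by (auto simp: polyhedral_decomposition_def)
    have "polyhedral_decomposition (n 0) (level_set_complex M f R)"
      unfolding polyhedral_decomposition_def
    proof
      show "polyhedral_complex (n 0) (level_set_complex M f R)"
        using IH R polyhedral_complex_level_set_complex [OF pos]
        by (auto simp: polyhedral_decomposition_def)
      show "\<Union>(level_set_complex M f R) = Rn (n 0)"
        unfolding Union_level_set_complex UM UR using f by blast
    qed
    moreover have
      "affine_linear_on_cells (n 0) (n (Suc i)) (layers_comp n W b (Suc i)) (level_set_complex M f R)"
      using affine_linear_on_cells_compose [OF IH(2) R(2)] by (simp add: f_def)
    moreover have "\<exists>C\<in>level_set_complex M f R. x \<in> C \<and> C \<subseteq> B \<union> bent_hyperplanes n W b (Suc i)"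
      if x: "x \<in> B \<union> bent_hyperplanes n W b (Suc i)" for x
    proof -
      have "\<exists>S\<in>M. \<exists>Y\<in>R. x \<in> S \<and> f x \<in> Y \<and> S \<inter> f -` Y \<subseteq> B \<union> bent_hyperplanes n W b (Suc i)"
      proof (cases "x \<in> B")
        case True
        \<comment> \<open>On an old bent hyperplane an old cell inside \<open>B\<close> is refined
          by any \<open>Y\<close> containing \<open>f x\<close>, and the result stays inside
          \<open>B\<close>.\<close>
        then obtain S where S: "S \<in> M" "x \<in> S" "S \<subseteq> B" using IH(3) by blast
        have "x \<in> Rn (n 0)" using UnionI [OF S(1,2)] unfolding UM .
        then have "f x \<in> \<Union>R" using f unfolding UR by blast
        then obtain Y where "Y \<in> R" "f x \<in> Y" by blast
        with S show ?thesis by blast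
      next
        case False
        then obtain H where H: "H \<in> layer_arrangement n W b (Suc i)" "x \<in> Rn (n 0)" "f x \<in> H"
          using x by (auto simp: bent_hyperplanes_def f_def)
        \<comment> \<open>On a new bent hyperplane the roles are exchanged: \<open>Y\<close> is
          chosen inside \<open>H\<close>, and \<open>S\<close> is any old cell containing
          \<open>x\<close>.\<close>
        obtain Y where Y: "Y \<in> R" "f x \<in> Y" "Y \<subseteq> H"
          using layer_hyperplane_cell [OF H(1,3)] unfolding R_def by blast
        obtain S where S: "S \<in> M" "x \<in> S" using H(2) UM by blast
        have "S \<subseteq> Rn (n 0)" using S(1) UM by blast
        then have "S \<inter> f -` Y \<subseteq> bent_hyperplanes n W b (Suc i)"
          using H(1) Y(3) by (auto simp: bent_hyperplanes_def f_def)
        with S Y show ?thesis by blast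
      qed
      then show ?thesis by (auto simp: level_set_complex_def)
    qed
    ultimately show ?case unfolding M' B' by blast
  qed
  then show "polyhedral_decomposition (n 0) (layers_complex n W b i)"
    "affine_linear_on_cells (n 0) (n i) (layers_comp n W b i) (layers_complex n W b i)" ?bent
    by blast+
qed

section \<open>The statement for the whole network, including its output layer\<close>

theorem theorem1:
  fixes n :: "nat \<Rightarrow> nat" and m :: nat and W :: weights and b :: biases
  assumes "1 \<le> m"
    and "\<And>i. i \<le> m \<Longrightarrow> 0 < n i"
    and "n (m + 1) = 1"
  shows "(\<forall>i\<in>{1..m}.
            polyhedral_decomposition (n 0) (layers_complex n W b i) \<and>
            affine_linear_on_cells (n 0) (n i) (layers_comp n W b i) (layers_complex n W b i) \<and>
            (\<exists>\<N>. polyhedral_subcomplex (n 0) \<N> (layers_complex n W b i) \<and>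
                  \<Union>\<N> = (\<Union>k\<in>{1..i}. bent_hyperplanes n W b k))) \<and>
         polyhedral_decomposition (n 0) (canonical_complex n m W b) \<and>
         continuous_map (Euclidean_space (n 0)) (Euclidean_space 1) (network_map n m W b) \<and>
         affine_linear_on_cells (n 0) 1 (network_map n m W b) (canonical_complex n m W b)"
proof (intro conjI ballI)
  fix i assume i: "i \<in> {1..m}"
  then have "1 \<le> i" "\<forall>k<i. 0 < n k" using assms(2) by auto
  note props = layers_complex_properties [of i n W b, OF this]
  show "polyhedral_decomposition (n 0) (layers_complex n W b i)"
    "affine_linear_on_cells (n 0) (n i) (layers_comp n W b i) (layers_complex n W b i)"
    by (fact props(1), fact props(2))
  have "face_closed (n 0) (layers_complex n W b i)"
    using props(1) by (simp add: polyhedral_decomposition_def polyhedral_complex_def)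
  then show "\<exists>\<N>. polyhedral_subcomplex (n 0) \<N> (layers_complex n W b i) \<and>
      \<Union>\<N> = (\<Union>k\<in>{1..i}. bent_hyperplanes n W b k)"
    using subcomplex_of_subset props(3) by blast
next
  have "\<forall>k<m. 0 < n k" using assms(2) by auto
  note props = layers_complex_properties [of m n W b, OF assms(1) this]
  show "polyhedral_decomposition (n 0) (canonical_complex n m W b)"
    using props(1) by (simp add: canonical_complex_def)
  show "continuous_map (Euclidean_space (n 0)) (Euclidean_space 1) (network_map n m W b)"
    unfolding network_map_def layer_affine_def assms(3)
    using continuous_map_compose [OF continuous_map_layers_comp continuous_map_affine_map] by simp
  \<comment> \<open>The output layer carries no ReLU, so the cells of the last hidden layer need no
    refinement: on each of them two affine maps are composed.\<close>
  show "affine_linear_on_cells (n 0) 1 (network_map n m W b) (canonical_complex n m W b)"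
    unfolding affine_linear_on_cells_def
  proof
    fix S assume "S \<in> canonical_complex n m W b"
    then obtain V c where "\<forall>x\<in>S. layers_comp n W b m x = affine_map (n 0) (n m) V c x"
      using props(2) unfolding canonical_complex_def affine_linear_on_cells_def by blast
    then have "\<forall>x\<in>S. network_map n m W b x =
        affine_map (n m) 1 (W (m + 1)) (b (m + 1)) (affine_map (n 0) (n m) V c x)"
      using assms(3) by (simp add: network_map_def layer_affine_def)
    then show "\<exists>V c. \<forall>x\<in>S. network_map n m W b x = affine_map (n 0) 1 V c x"
      unfolding affine_map_affine_map by blast
  qed
qed

end
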